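(* Consider the linear model $Y=X\beta+w$ with $w\sim N(0,\sigma^2I_{n\times n})$ and a fixed design matrix $X\in\mathbb{R}^{n\times d}$ that is column-normalized: $\frac{1}{\sqrt n}\max_{j=1,\dots,d}\|X_j\|_2\le\kappa_c$ with $0<\kappa_c<\infty$. (a) Let $q\in(0,1]$ and $\kappa>0$. There is a constant $c'_{2,q}>0$, independent of $n,d,R_q,\sigma^2$ and $X$, such that the following holds. Consider a sequence of instances indexed by $n\to\infty$, with $d=d(n)$ and $R_q=R_q(n)>0$ satisfying $\frac{d}{R_qn^{q/2}}=\Omega(d^\kappa)$, and suppose that there are a constant $\kappa_\ell>0$ and a function $f_\ell(R_q,n,d)=o\big(R_q^{1/2}(\frac{\log d}{n})^{1/2-q/4}\big)$ such that $$\frac{1}{\sqrt n}\|X\theta\|_2\ge\kappa_\ell\|\theta\|_2-f_\ell(R_q,n,d)\qquad\text{for all }\theta\in\mathbb{B}_q(2R_q).$$ Then, for all sufficiently large $n$, the minimax prediction risk satisfies $$\min_{\hat\beta}\max_{\beta\in\mathbb{B}_q(R_q)}\mathbb{E}\,\frac{\|X(\hat\beta-\beta)\|_2^2}{n}\;\ge\;c'_{2,q}\,R_q\,\kappa_\ell^2\Big[\frac{\sigma^2}{\kappa_c^2}\,\frac{\log d}{n}\Big]^{1-q/2}.$$ (b) Let $q=0$. There is a constant $c'_{0}>0$, independent of $n,d,s,\sigma^2$ and $X$, such that if, for some $\kappa_\ell>0$ and $\kappa_u<\infty$, one has $\kappa_\ell\|\theta\|_2\le\frac{1}{\sqrt n}\|X\theta\|_2\le\kappa_u\|\theta\|_2$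 for all $\theta\in\mathbb{B}_0(2s)$, then $$\min_{\hat\beta}\max_{\beta\in\mathbb{B}_0(s)}\mathbb{E}\,\frac{\|X(\hat\beta-\beta)\|_2^2}{n}\;\ge\;c'_{0}\,\kappa_\ell^2\,\frac{\sigma^2}{\kappa_u^2}\,\frac{s\log(d/s)}{n}.$$
   Context: $X_j$ denotes the $j$-th column of $X$. For $q\in(0,1]$, $\mathbb{B}_q(R)=\{\beta\in\mathbb{R}^d:\sum_{j=1}^d|\beta_j|^q\le R\}$; $\mathbb{B}_0(s)=\{\beta\in\mathbb{R}^d:\sum_{j=1}^d\mathbb{I}[\beta_j\neq0]\le s\}$. The minimum over $\hat\beta$ is the infimum over all estimators, i.e. measurable functions $\hat\beta=\hat\beta(Y,X)\in\mathbb{R}^d$; the expectation is over $w$; the maximum is a supremum. The quantities $\sigma,\kappa_c,\kappa_\ell,\kappa_u$ are positive constants, fixed along sequences of instances; the constant $c'_{2,q}$ may depend on $q$ and on the fixed exponent $\kappa$ in the scaling condition.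
   Formalization: Part (a) is proved under two extra hypotheses, without which it fails: d(n) tends to infinity, and R_q ≥ [(σ²/κ_c²)(log d)/n]^{q/2} for all large n. In (b), 1 ≤ s ≤ d. *)

theory Defs
  imports "HOL-Probability.Probability" "HOL-Library.Landau_Symbols"
begin

text \<open>
  The dimensions \<open>n\<close> and \<open>d\<close> vary along a sequence, so vectors in \<open>\<real>\<^sup>d\<close> are extensional functions
  on \<open>{..<d}\<close> (the points of the product space \<open>Pi\<^sub>M {..<d} (\<lambda>_. borel)\<close>), and an \<open>n \<times> d\<close> matrix
  is a function \<open>X\<close> of which only the entries \<open>X i j\<close> with \<open>i < n\<close> and \<open>j < d\<close> are ever used.
\<close>

definition mat_vec :: "nat \<Rightarrow> (nat \<Rightarrow> nat \<Rightarrow> real) \<Rightarrow> (nat \<Rightarrow> real) \<Rightarrow> nat \<Rightarrow> real" where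
  "mat_vec d X \<theta> i = (\<Sum>j<d. X i j * \<theta> j)"

definition lq_ball :: "nat \<Rightarrow> real \<Rightarrow> real \<Rightarrow> (nat \<Rightarrow> real) set" where
  "lq_ball d q R = {\<beta> \<in> {..<d} \<rightarrow>\<^sub>E UNIV. (\<Sum>j<d. \<bar>\<beta> j\<bar> powr q) \<le> R}"

definition l0_ball :: "nat \<Rightarrow> nat \<Rightarrow> (nat \<Rightarrow> real) set" where
  "l0_ball d s = {\<beta> \<in> {..<d} \<rightarrow>\<^sub>E UNIV. (\<Sum>j<d. of_bool (\<beta> j \<noteq> 0)) \<le> s}"

text \<open>Meaningful for \<open>n \<ge> 1\<close> and \<open>d \<ge> 1\<close> only (the maximum over an empty set is unspecified).\<close>

definition column_normalized :: "nat \<Rightarrow> nat \<Rightarrow> (nat \<Rightarrow> nat \<Rightarrow> real) \<Rightarrow> real \<Rightarrow> bool" where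
  "column_normalized n d X \<kappa>\<^sub>c \<longleftrightarrow>
     1 / sqrt (real n) * (MAX j\<in>{..<d}. L2_set (\<lambda>i. X i j) {..<n}) \<le> \<kappa>\<^sub>c"

text \<open>\<open>N(0, \<sigma>\<^sup>2 I)\<close> as the product of \<open>n\<close> copies of \<open>N(0, \<sigma>\<^sup>2)\<close>; \<open>normal_density\<close> takes the standard
  deviation, not the variance.\<close>

definition gaussian_noise :: "nat \<Rightarrow> real \<Rightarrow> (nat \<Rightarrow> real) measure" where
  "gaussian_noise n \<sigma> = Pi\<^sub>M {..<n} (\<lambda>_. density lborel (\<lambda>x. ennreal (normal_density 0 \<sigma> x)))"

definition response :: "nat \<Rightarrow> nat \<Rightarrow> (nat \<Rightarrow> nat \<Rightarrow> real) \<Rightarrow> (nat \<Rightarrow> real) \<Rightarrow> (nat \<Rightarrow> real) \<Rightarrow> nat \<Rightarrow> real"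
  where "response n d X \<beta> w = (\<lambda>i\<in>{..<n}. mat_vec d X \<beta> i + w i)"

text \<open>The design is fixed and known: an estimator is a measurable function of the response, and it
  may depend on the design in an arbitrary way because it is chosen after \<open>X\<close>.\<close>

definition estimators :: "nat \<Rightarrow> nat \<Rightarrow> ((nat \<Rightarrow> real) \<Rightarrow> nat \<Rightarrow> real) set" where
  "estimators n d = Pi\<^sub>M {..<n} (\<lambda>_. borel) \<rightarrow>\<^sub>M Pi\<^sub>M {..<d} (\<lambda>_. borel)"

text \<open>The expectation is a nonnegative integral, so that estimators of infinite risk are covered.\<close>

definition prediction_risk ::
  "nat \<Rightarrow> nat \<Rightarrow> real \<Rightarrow> (nat \<Rightarrow> nat \<Rightarrow> real) \<Rightarrow> ((nat \<Rightarrow> real) \<Rightarrow> nat \<Rightarrow> real) \<Rightarrow> (nat \<Rightarrow> real) \<Rightarrow> ennreal"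
  where
  "prediction_risk n d \<sigma> X est \<beta> =
     (\<integral>\<^sup>+ w. ennreal ((L2_set (mat_vec d X (\<lambda>j. est (response n d X \<beta> w) j - \<beta> j)) {..<n})\<^sup>2 / real n)
       \<partial>gaussian_noise n \<sigma>)"

definition minimax_prediction_risk ::
  "nat \<Rightarrow> nat \<Rightarrow> real \<Rightarrow> (nat \<Rightarrow> nat \<Rightarrow> real) \<Rightarrow> (nat \<Rightarrow> real) set \<Rightarrow> ennreal" where
  "minimax_prediction_risk n d \<sigma> X B =
     (INF est\<in>estimators n d. SUP \<beta>\<in>B. prediction_risk n d \<sigma> X est \<beta>)"

end

theory Submission
  imports Defs
begin

text \<open>
  Cut \<open>K * m\<close> of the coordinates into \<open>K\<close> blocks of length \<open>m\<close> and put a uniform prior on the vectors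
  with exactly one entry \<open>\<delta>\<close> per block. Replacing an estimate by the nearest such vector (in
  prediction norm) costs a factor of two, and the restricted eigenvalue condition turns its loss
  into a number of wrongly selected blocks, which is a sum over blocks. Given the other blocks,
  selecting one block is a test between \<open>m\<close> Gaussian means at distance
  \<open>\<delta> \<parallel>X\<^sub>j\<parallel> \<le> \<sigma> (ln m / 2)\<^sup>1\<^sup>/\<^sup>2\<close> from a common centre; a second-moment bound on the
  likelihood ratios shows that it fails with probability at least \<open>1 - m\<^sup>-\<^sup>1\<^sup>/\<^sup>4 \<ge> 1/8\<close>. No packing
  lemma and no Fano inequality is needed, and the minimax risk is at least of order
  \<open>K \<kappa>\<^sub>l\<^sup>2 \<delta>\<^sup>2\<close>.
  For \<open>q > 0\<close> take \<open>\<delta>\<^sup>2\<close> of order \<open>\<sigma>\<^sup>2 ln d / (\<kappa>\<^sub>c\<^sup>2 n)\<close> and \<open>K\<close> about \<open>R / \<delta>\<^sup>q\<close>;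
  for \<open>q = 0\<close> take \<open>K = s\<close> (or half of \<open>d\<close> when \<open>d < 2s\<close>).
\<close>

section \<open>Gaussian product densities and the law of the response\<close>

definition gauss_dens :: "nat \<Rightarrow> real \<Rightarrow> (nat \<Rightarrow> real) \<Rightarrow> (nat \<Rightarrow> real) \<Rightarrow> real" where
  "gauss_dens n \<sigma> \<mu> y = (\<Prod>i<n. normal_density (\<mu> i) \<sigma> (y i))"

text \<open>The common dominating measure of all hypotheses: densities of different means can be
  compared and summed pointwise before anything is integrated.\<close>

abbreviation leb :: "nat \<Rightarrow> (nat \<Rightarrow> real) measure" where
  "leb n \<equiv> Pi\<^sub>M {..<n} (\<lambda>_. lborel)"

lemma measurable_leb: "f \<in> Pi\<^sub>M {..<n} (\<lambda>_. borel) \<rightarrow>\<^sub>M N \<Longrightarrow> f \<in> leb n \<rightarrow>\<^sub>M N"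
  by (subst measurable_cong_sets[where M' = "Pi\<^sub>M {..<n} (\<lambda>_. borel)"])
    (auto intro!: sets_PiM_cong)

lemma gauss_dens_pos: "0 < \<sigma> \<Longrightarrow> 0 < gauss_dens n \<sigma> \<mu> y"
  unfolding gauss_dens_def by (intro prod_pos) (simp add: normal_density_pos)

lemma gauss_dens_nonneg: "0 \<le> gauss_dens n \<sigma> \<mu> y"
  unfolding gauss_dens_def by (intro prod_nonneg) simp

lemma borel_measurable_gauss_dens [measurable]: "gauss_dens n \<sigma> \<mu> \<in> borel_measurable (leb n)"
  unfolding gauss_dens_def[abs_def] by measurable

text \<open>The parallelogram identity: the point \<open>x - (m + v)\<close> is the midpoint of
  \<open>x - m\<close> and \<open>x - (m + 2 * v)\<close>, so twice its square is the sum of their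
  squares minus \<open>2 * v\<^sup>2\<close>. The normalizing constants agree on both sides.\<close>

lemma normal_density_square:
  "(normal_density (m + v) \<sigma> x)\<^sup>2 =
    exp (v\<^sup>2 / \<sigma>\<^sup>2) * normal_density m \<sigma> x * normal_density (m + 2 * v) \<sigma> x"
proof -
  define a where "a = 2 * \<sigma>\<^sup>2"
  have va: "v\<^sup>2 / \<sigma>\<^sup>2 = 2 * v\<^sup>2 / a" by (simp add: a_def)
  have "- (x - (m + v))\<^sup>2 * 2 = 2 * v\<^sup>2 + - (x - m)\<^sup>2 + - (x - (m + 2 * v))\<^sup>2"
    by algebra
  then have "2 * (- (x - (m + v))\<^sup>2 / (2 * \<sigma>\<^sup>2)) =
      v\<^sup>2 / \<sigma>\<^sup>2 + - (x - m)\<^sup>2 / (2 * \<sigma>\<^sup>2) + - (x - (m + 2 * v))\<^sup>2 / (2 * \<sigma>\<^sup>2)"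
    unfolding va a_def[symmetric] add_divide_distrib[symmetric] by (simp only: times_divide_eq_right mult.commute)
  then have "exp (- (x - (m + v))\<^sup>2 / (2 * \<sigma>\<^sup>2)) * exp (- (x - (m + v))\<^sup>2 / (2 * \<sigma>\<^sup>2)) =
      exp (v\<^sup>2 / \<sigma>\<^sup>2) * exp (- (x - m)\<^sup>2 / (2 * \<sigma>\<^sup>2)) * exp (- (x - (m + 2 * v))\<^sup>2 / (2 * \<sigma>\<^sup>2))"
    by (simp only: exp_add[symmetric] mult_2)
  moreover have "(k * e)\<^sup>2 = E * (k * e\<^sub>1) * (k * e\<^sub>2)" if "e * e = E * e\<^sub>1 * e\<^sub>2" for k e E e\<^sub>1 e\<^sub>2 :: real
    using that by algebra
  ultimately show ?thesis
    unfolding normal_density_def by blast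
qed

text \<open>The square of a shifted density divided by the centred one is again a multiple of a Gaussian
  density, so second moments of likelihood ratios need no further integration.\<close>

lemma gauss_dens_square:
  "(gauss_dens n \<sigma> (\<lambda>i. \<mu> i + v i) y)\<^sup>2 =
    exp ((\<Sum>i<n. (v i)\<^sup>2) / \<sigma>\<^sup>2) * gauss_dens n \<sigma> \<mu> y * gauss_dens n \<sigma> (\<lambda>i. \<mu> i + 2 * v i) y"
proof -
  have "(gauss_dens n \<sigma> (\<lambda>i. \<mu> i + v i) y)\<^sup>2 = (\<Prod>i<n. (normal_density (\<mu> i + v i) \<sigma> (y i))\<^sup>2)"
    unfolding gauss_dens_def by (rule prod_power_distrib)
  also have "\<dots> = (\<Prod>i<n. exp ((v i)\<^sup>2 / \<sigma>\<^sup>2)) * gauss_dens n \<sigma> \<mu> y *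
      gauss_dens n \<sigma> (\<lambda>i. \<mu> i + 2 * v i) y"
    unfolding gauss_dens_def normal_density_square prod.distrib ..
  also have "(\<Prod>i<n. exp ((v i)\<^sup>2 / \<sigma>\<^sup>2)) = exp ((\<Sum>i<n. (v i)\<^sup>2) / \<sigma>\<^sup>2)"
    by (simp add: exp_sum sum_divide_distrib)
  finally show ?thesis .
qed

lemma has_bochner_integral_gauss_dens:
  assumes "0 < \<sigma>"
  shows "has_bochner_integral (leb n) (gauss_dens n \<sigma> \<mu>) 1"
proof -
  interpret product_sigma_finite "\<lambda>_::nat. lborel :: real measure" ..
  have "(\<integral>\<^sup>+y. ennreal (gauss_dens n \<sigma> \<mu> y) \<partial>leb n) =
    (\<integral>\<^sup>+y. (\<Prod>i<n. ennreal (normal_density (\<mu> i) \<sigma> (y i))) \<partial>leb n)"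
    by (simp add: gauss_dens_def prod_ennreal)
  also have "\<dots> = (\<Prod>i<n. \<integral>\<^sup>+x. ennreal (normal_density (\<mu> i) \<sigma> x) \<partial>lborel)"
    by (rule product_nn_integral_prod) auto
  also have "\<dots> = ennreal 1"
    using assms by (simp add: nn_integral_eq_integral integrable_normal_density)
  finally show ?thesis
    by (intro has_bochner_integral_nn_integral) (auto simp: gauss_dens_nonneg)
qed

lemma distr_shift_normal:
  assumes "0 < \<sigma>"
  shows "distr (density lborel (\<lambda>x. ennreal (normal_density 0 \<sigma> x))) borel ((+) m) =
    density lborel (\<lambda>x. ennreal (normal_density m \<sigma> x))"
proof -
  have "distr (density lborel (\<lambda>x. ennreal (normal_density 0 \<sigma> x))) borel ((+) m) =
    density (distr lborel borel ((+) m)) (\<lambda>x. ennreal (normal_density m \<sigma> x))"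
    by (subst density_distr) (auto simp: normal_density_def)
  then show ?thesis
    by (simp add: lborel_distr_plus)
qed

text \<open>A change of variables that moves the mean from the argument of \<open>F\<close> into the
  density. The image of the noise under the shift and the measure with density
  \<open>gauss_dens n \<sigma> \<mu>\<close> agree on boxes, hence both are the same product of
  one-dimensional normal laws.\<close>

lemma nn_integral_gaussian_response:
  assumes "0 < \<sigma>" and F [measurable]: "F \<in> borel_measurable (Pi\<^sub>M {..<n} (\<lambda>_. borel))"
  shows "(\<integral>\<^sup>+w. F (\<lambda>i\<in>{..<n}. \<mu> i + w i) \<partial>gaussian_noise n \<sigma>) =
    (\<integral>\<^sup>+y. ennreal (gauss_dens n \<sigma> \<mu> y) * F y \<partial>leb n)"
proof -
  let ?N = "\<lambda>m. density lborel (\<lambda>x. ennreal (normal_density m \<sigma> x))"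
  let ?D = "distr (gaussian_noise n \<sigma>) (Pi\<^sub>M {..<n} (\<lambda>_. borel)) (\<lambda>w. \<lambda>i\<in>{..<n}. \<mu> i + w i)"
  interpret L: product_sigma_finite "\<lambda>_::nat. lborel :: real measure" ..
  interpret N: prob_space "?N m" for m
    by (rule prob_space_normal_density) fact
  interpret Z: product_sigma_finite "\<lambda>_::nat. ?N 0" ..
  interpret S: product_sigma_finite "\<lambda>i::nat. ?N (\<mu> i)" ..
  have meas [measurable]: "(\<lambda>w. \<lambda>i\<in>{..<n}. \<mu> i + w i) \<in> gaussian_noise n \<sigma> \<rightarrow>\<^sub>M Pi\<^sub>M {..<n} (\<lambda>_. borel)"
    unfolding gaussian_noise_def by (intro measurable_restrict) measurable
  have sp: "space (gaussian_noise n \<sigma>) = Pi\<^sub>E {..<n} (\<lambda>_. UNIV)"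
    by (simp add: gaussian_noise_def space_PiM)
  have D: "?D = Pi\<^sub>M {..<n} (\<lambda>i. ?N (\<mu> i))"
  proof (rule S.PiM_eqI)
    show "sets ?D = sets (Pi\<^sub>M {..<n} (\<lambda>i. ?N (\<mu> i)))"
      by (simp, intro sets_PiM_cong) simp_all
    fix A :: "nat \<Rightarrow> real set" assume "\<And>i. i \<in> {..<n} \<Longrightarrow> A i \<in> sets (?N (\<mu> i))"
    then have A: "\<And>i. i < n \<Longrightarrow> A i \<in> sets borel" by simp
    have "emeasure ?D (Pi\<^sub>E {..<n} A) =
      emeasure (gaussian_noise n \<sigma>) (Pi\<^sub>E {..<n} (\<lambda>i. (+) (\<mu> i) -` A i))"
      using A by (subst emeasure_distr) (auto intro!: sets_PiM_I_finite arg_cong2[where f = emeasure] 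
        simp: sp PiE_iff)
    also have "\<dots> = (\<Prod>i<n. emeasure (?N 0) ((+) (\<mu> i) -` A i))"
      unfolding gaussian_noise_def
      by (rule Z.emeasure_PiM) (auto intro!: measurable_sets_borel[OF _ A])
    also have "\<dots> = (\<Prod>i<n. emeasure (distr (?N 0) borel ((+) (\<mu> i))) (A i))"
      using A by (intro prod.cong refl) (simp add: emeasure_distr)
    finally show "emeasure ?D (Pi\<^sub>E {..<n} A) = (\<Prod>i<n. emeasure (?N (\<mu> i)) (A i))"
      by (simp add: distr_shift_normal assms)
  qed simp
  have "density (leb n) (\<lambda>y. ennreal (gauss_dens n \<sigma> \<mu> y)) = Pi\<^sub>M {..<n} (\<lambda>i. ?N (\<mu> i))"
    (is "?G = _")
  proof (rule S.PiM_eqI)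
    show "sets ?G = sets (Pi\<^sub>M {..<n} (\<lambda>i. ?N (\<mu> i)))"
      by (simp, intro sets_PiM_cong) simp_all
    fix A :: "nat \<Rightarrow> real set" assume "\<And>i. i \<in> {..<n} \<Longrightarrow> A i \<in> sets (?N (\<mu> i))"
    then have A: "\<And>i. i < n \<Longrightarrow> A i \<in> sets borel" by simp
    have "emeasure ?G (Pi\<^sub>E {..<n} A) =
      (\<integral>\<^sup>+y. ennreal (gauss_dens n \<sigma> \<mu> y) * indicator (Pi\<^sub>E {..<n} A) y \<partial>leb n)"
      using A by (intro emeasure_density) (auto intro!: sets_PiM_I_finite)
    also have "\<dots> = (\<integral>\<^sup>+y. (\<Prod>i<n. ennreal (normal_density (\<mu> i) \<sigma> (y i)) * indicator (A i) (y i)) \<partial>leb n)"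
      by (intro nn_integral_cong)
        (auto simp: gauss_dens_def prod_ennreal prod.distrib indicator_def space_PiM PiE_iff)
    also have "\<dots> = (\<Prod>i<n. \<integral>\<^sup>+x. ennreal (normal_density (\<mu> i) \<sigma> x) * indicator (A i) x \<partial>lborel)"
      using A by (intro L.product_nn_integral_prod) auto
    finally show "emeasure ?G (Pi\<^sub>E {..<n} A) = (\<Prod>i<n. emeasure (?N (\<mu> i)) (A i))"
      using A by (simp add: emeasure_density)
  qed simp
  then have "?D = ?G" by (simp add: D)
  have "(\<integral>\<^sup>+w. F (\<lambda>i\<in>{..<n}. \<mu> i + w i) \<partial>gaussian_noise n \<sigma>) = (\<integral>\<^sup>+y. F y \<partial>?D)"
    by (rule nn_integral_distr[symmetric]) measurable
  also have "\<dots> = (\<integral>\<^sup>+y. ennreal (gauss_dens n \<sigma> \<mu> y) * F y \<partial>leb n)"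
    unfolding \<open>?D = ?G\<close> 
    by (rule nn_integral_density) (simp_all add: measurable_leb[OF F])
  finally show ?thesis .
qed

section \<open>Block vectors and the selectors that index the prior\<close>

definition block_vector :: "nat \<Rightarrow> nat \<Rightarrow> nat \<Rightarrow> real \<Rightarrow> (nat \<Rightarrow> nat) \<Rightarrow> nat \<Rightarrow> real" where
  "block_vector d K m \<delta> g = (\<lambda>j\<in>{..<d}. if j < K * m \<and> j mod m = g (j div m) then \<delta> else 0)"

text \<open>Extensionality makes this set finite, so it carries a uniform prior, and it stays closed
  under \<open>g(b := j)\<close> for \<open>b < K\<close> and \<open>j < m\<close>.\<close>

definition selectors :: "nat \<Rightarrow> nat \<Rightarrow> (nat \<Rightarrow> nat) set" where
  "selectors K m = Pi\<^sub>E {..<K} (\<lambda>_. {..<m})"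

lemma finite_selectors [simp]: "finite (selectors K m)"
  unfolding selectors_def by (intro finite_PiE) auto

lemma selectors_upd: "g \<in> selectors K m \<Longrightarrow> b < K \<Longrightarrow> j < m \<Longrightarrow> g(b := j) \<in> selectors K m"
  unfolding selectors_def by (auto simp: PiE_iff extensional_def)

lemma selectors_less: "g \<in> selectors K m \<Longrightarrow> b < K \<Longrightarrow> g b < m"
  unfolding selectors_def by auto

lemma card_selectors_pos: "0 < m \<Longrightarrow> 0 < card (selectors K m)"
  unfolding selectors_def by (simp add: card_PiE)

lemma block_index_less:
  fixes b K m r :: nat
  assumes "b < K" "r < m" shows "b * m + r < K * m"
proof -
  have "b * m + r < Suc b * m" using assms by simp
  also have "\<dots> \<le> K * m" using assms by (intro mult_le_mono1) simp
  finally show ?thesis .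
qed

lemma block_index_div:
  fixes b m r :: nat
  shows "r < m \<Longrightarrow> (b * m + r) div m = b"
  by (cases "m = 0") simp_all

text \<open>Resampling a block: the map \<open>(g, j) \<mapsto> (g(b := j), g b)\<close> is an involution.\<close>

lemma sum_selectors_resample:
  fixes F :: "(nat \<Rightarrow> nat) \<Rightarrow> 'a :: comm_semiring_1"
  assumes "b < K"
  shows "(\<Sum>g\<in>selectors K m. \<Sum>j<m. F (g(b := j))) = of_nat m * (\<Sum>g\<in>selectors K m. F g)"
proof -
  have "(\<Sum>(g, j)\<in>selectors K m \<times> {..<m}. F (g(b := j))) = (\<Sum>(g, j)\<in>selectors K m \<times> {..<m}. F g)"
    by (rule sum.reindex_bij_witness[where i = "\<lambda>(g, j). (g(b := j), g b)" and j = "\<lambda>(g, j). (g(b := j), g b)"])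
      (auto simp: assms selectors_upd selectors_less)
  then show ?thesis
    by (simp add: sum.cartesian_product[symmetric] sum_distrib_left)
qed

text \<open>Entries can be nonzero only at the \<open>K\<close> distinct coordinates
  \<open>b * m + g b\<close>. The function \<open>\<phi>\<close> is left general so that one
  argument covers matrix products, weighted squares, counts of nonzero entries and sums of q-th
  powers.\<close>

lemma sum_block_vector:
  fixes \<phi> :: "nat \<Rightarrow> real \<Rightarrow> 'a :: comm_monoid_add"
  assumes g: "g \<in> selectors K m" and d: "K * m \<le> d" and zero: "\<And>j. \<phi> j 0 = 0"
  shows "(\<Sum>j<d. \<phi> j (block_vector d K m \<delta> g j)) = (\<Sum>b<K. \<phi> (b * m + g b) \<delta>)"
proof -
  have inj: "inj_on (\<lambda>b. b * m + g b) {..<K}"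
  proof (rule inj_onI)
    fix b c assume "b \<in> {..<K}" "c \<in> {..<K}" and eq: "b * m + g b = c * m + g c"
    then have "(b * m + g b) div m = b" "(c * m + g c) div m = c"
      by (intro block_index_div selectors_less[OF g]; simp)+
    then show "b = c" unfolding eq by simp
  qed
  have "(\<Sum>b<K. \<phi> (b * m + g b) \<delta>) = (\<Sum>j\<in>(\<lambda>b. b * m + g b) ` {..<K}. \<phi> j \<delta>)"
    by (simp add: sum.reindex[OF inj])
  also have "\<dots> = (\<Sum>j<d. \<phi> j (block_vector d K m \<delta> g j))"
  proof (rule sum.mono_neutral_cong_left)
    show "(\<lambda>b. b * m + g b) ` {..<K} \<subseteq> {..<d}"
      using d block_index_less[OF _ selectors_less[OF g]] by fastforce
    show "\<forall>j\<in>{..<d} - (\<lambda>b. b * m + g b) ` {..<K}. \<phi> j (block_vector d K m \<delta> g j) = 0"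
    proof
      fix j assume j: "j \<in> {..<d} - (\<lambda>b. b * m + g b) ` {..<K}"
      have "\<not> (j < K * m \<and> j mod m = g (j div m))"
      proof
        assume *: "j < K * m \<and> j mod m = g (j div m)"
        then have "j div m < K" by (simp add: less_mult_imp_div_less)
        moreover have "j = (j div m) * m + g (j div m)" using * by (metis div_mult_mod_eq)
        ultimately show False using j by blast
      qed
      then show "\<phi> j (block_vector d K m \<delta> g j) = 0"
        using j by (auto simp: block_vector_def zero)
    qed
    fix j assume "j \<in> (\<lambda>b. b * m + g b) ` {..<K}"
    then obtain b where b: "b < K" "j = b * m + g b" by auto
    then show "\<phi> j \<delta> = \<phi> j (block_vector d K m \<delta> g j)"
      using selectors_less[OF g b(1)] block_index_less[OF b(1) selectors_less[OF g b(1)]] d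
      by (simp add: block_vector_def)
  qed simp
  finally show ?thesis ..
qed

lemma block_vector_extensional: "block_vector d K m \<delta> g \<in> {..<d} \<rightarrow>\<^sub>E UNIV"
  by (simp add: block_vector_def)

lemma mat_vec_block_vector:
  assumes "g \<in> selectors K m" "K * m \<le> d"
  shows "mat_vec d X (block_vector d K m \<delta> g) i = (\<Sum>b<K. X i (b * m + g b) * \<delta>)"
  unfolding mat_vec_def using sum_block_vector[OF assms, of "\<lambda>j x. X i j * x"] by simp

lemma mat_vec_diff: "mat_vec d X (\<lambda>j. u j - v j) i = mat_vec d X u i - mat_vec d X v i"
  by (simp add: mat_vec_def algebra_simps sum_subtractf)

section \<open>Pointwise inequalities between prediction loss and wrongly selected blocks\<close>

definition block_distance :: "nat \<Rightarrow> (nat \<Rightarrow> nat) \<Rightarrow> (nat \<Rightarrow> nat) \<Rightarrow> nat" where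
  "block_distance K g h = (\<Sum>b<K. of_bool (g b \<noteq> h b))"

text \<open>A block on which the selectors differ holds two entries \<delta> of opposite sign in the
  difference. Only the one placed by \<open>g\<close> is counted, which gives
  \<open>\<delta>\<^sup>2\<close> per wrong block.\<close>

lemma block_vector_separation:
  assumes g: "g \<in> selectors K m" and h: "h \<in> selectors K m" and d: "K * m \<le> d"
  shows "\<delta>\<^sup>2 * real (block_distance K g h) \<le>
    (L2_set (\<lambda>j\<in>{..<d}. block_vector d K m \<delta> g j - block_vector d K m \<delta> h j) {..<d})\<^sup>2"
proof -
  let ?u = "block_vector d K m \<delta> g" and ?v = "block_vector d K m \<delta> h"
  have "\<delta>\<^sup>2 * real (block_distance K g h) = (\<Sum>b<K. of_bool (g b \<noteq> h b) * \<delta>\<^sup>2)"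
    unfolding block_distance_def of_nat_sum sum_distrib_right[symmetric] of_nat_of_bool
    by (rule mult.commute)
  \<comment> \<open>The block number is recovered from the coordinate, so that the weight becomes a
    function of the coordinate and \<open>sum_block_vector\<close> applies.\<close>
  also have "\<dots> = (\<Sum>b<K. of_bool (g ((b * m + g b) div m) \<noteq> h ((b * m + g b) div m)) * \<delta>\<^sup>2)"
    by (intro sum.cong) (simp_all add: block_index_div selectors_less[OF g])
  also have "\<dots> = (\<Sum>j<d. of_bool (g (j div m) \<noteq> h (j div m)) * (?u j)\<^sup>2)"
    using sum_block_vector[OF g d, of "\<lambda>j x. of_bool (g (j div m) \<noteq> h (j div m)) * x\<^sup>2"] by simp
  also have "\<dots> \<le> (\<Sum>j<d. (?u j - ?v j)\<^sup>2)"
    by (intro sum_mono) (auto simp: block_vector_def)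
  finally show ?thesis
    by (simp add: L2_set_def sum_nonneg)
qed

text \<open>Whatever hypothesis \<open>k\<close> is chosen, \<open>p k \<le> t (p k)\<^sup>2 / (2 r) + r / (2 t)\<close>, and the error term is made
  independent of \<open>k\<close> by summing over all hypotheses; hence no measurability of the choice is needed.\<close>

lemma many_hypotheses_pointwise:
  fixes p q :: "nat \<Rightarrow> real"
  assumes pq: "\<And>j. j < m \<Longrightarrow> (p j)\<^sup>2 \<le> E * r * q j" and "0 \<le> E" "0 < r" "\<And>j. j < m \<Longrightarrow> 0 \<le> p j" "\<And>j. j < m \<Longrightarrow> 0 \<le> q j" "0 < t"
  shows "(\<Sum>j<m. p j) \<le> (\<Sum>j<m. p j * of_bool (k \<noteq> j)) + (t / 2 * E * (\<Sum>j<m. q j) + r / (2 * t))"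
proof (cases "k < m")
  case True
  have "(\<Sum>j<m. p j) = (\<Sum>j<m. p j * of_bool (k \<noteq> j)) + p k"
  proof -
    have "(\<Sum>j<m. p j) = (\<Sum>j<m. p j * of_bool (k \<noteq> j) + (if j = k then p j else 0))"
      by (intro sum.cong) auto
    then show ?thesis using True by (simp only: sum.distrib) simp
  qed
  moreover have "p k \<le> t / 2 * E * q k + r / (2 * t)"
  proof -
    have "2 * t * r * p k \<le> t\<^sup>2 * (p k)\<^sup>2 + r\<^sup>2"
      using zero_le_power2[of "t * p k - r"] by (simp add: power2_eq_square algebra_simps)
    also have "\<dots> \<le> t\<^sup>2 * (E * r * q k) + r\<^sup>2"
      using pq[OF True] by (intro add_mono mult_left_mono) auto
    also have "\<dots> = 2 * t * r * (t / 2 * E * q k + r / (2 * t))"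
      using assms by (simp add: power2_eq_square field_simps)
    finally show ?thesis using assms by simp
  qed
  moreover have "t / 2 * E * q k \<le> t / 2 * E * (\<Sum>j<m. q j)"
    using True assms by (intro mult_left_mono member_le_sum) auto
  ultimately show ?thesis by linarith
next
  \<comment> \<open>An answer outside the range is wrong under every hypothesis, and the error term
    is nonnegative.\<close>
  case False
  then have "(\<Sum>j<m. p j * of_bool (k \<noteq> j)) = (\<Sum>j<m. p j)"
    by (intro sum.cong) auto
  moreover have "0 \<le> (\<Sum>j<m. q j)" using assms by (intro sum_nonneg) auto
  then have "0 \<le> t / 2 * E * (\<Sum>j<m. q j)" "0 \<le> r / (2 * t)" using assms by auto
  ultimately show ?thesis by linarith
qed

lemma L2_set_uminus: "L2_set (\<lambda>i. - f i) A = L2_set f A"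
  by (simp add: L2_set_def)

lemma L2_set_squared: "(L2_set f A)\<^sup>2 = (\<Sum>i\<in>A. (f i)\<^sup>2)"
  by (simp add: L2_set_def sum_nonneg)

lemma mat_vec_restrict: "mat_vec d X (restrict u {..<d}) = mat_vec d X u"
  by (simp add: mat_vec_def fun_eq_iff)

text \<open>The selector \<open>k\<close> minimizes the prediction distance to \<open>u\<close>. By
  the triangle inequality its block vector is within \<open>2 * N g\<close> of that of any
  \<open>g\<close>, and the restricted eigenvalue condition converts this into a number of wrong
  blocks. The constants come from
  \<open>(2 * x + f)\<^sup>2 \<le> 8 * x\<^sup>2 + 2 * f\<^sup>2\<close>, divided by 8.\<close>

lemma nearest_selector:
  assumes n: "1 \<le> n" and m: "0 < m" and d: "K * m \<le> d" and \<kappa>: "0 \<le> \<kappa>"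
    and sep: "\<And>g h. g \<in> selectors K m \<Longrightarrow> h \<in> selectors K m \<Longrightarrow>
      \<kappa> * L2_set (\<lambda>j\<in>{..<d}. block_vector d K m \<delta> g j - block_vector d K m \<delta> h j) {..<d} - f \<le>
      1 / sqrt (real n) * L2_set (mat_vec d X (\<lambda>j\<in>{..<d}. block_vector d K m \<delta> g j - block_vector d K m \<delta> h j)) {..<n}"
  shows "\<exists>k\<in>selectors K m. \<forall>g\<in>selectors K m. \<kappa>\<^sup>2 * \<delta>\<^sup>2 / 8 * real (block_distance K k g) \<le>
    (L2_set (mat_vec d X (\<lambda>j. u j - block_vector d K m \<delta> g j)) {..<n})\<^sup>2 / real n + f\<^sup>2 / 4"
proof -
  define N where "N g = L2_set (mat_vec d X (\<lambda>j. u j - block_vector d K m \<delta> g j)) {..<n}" for g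
  have ne: "selectors K m \<noteq> {}"
    using card_selectors_pos[OF m, of K] by auto
  obtain k where k: "k \<in> selectors K m" "\<And>g. g \<in> selectors K m \<Longrightarrow> N k \<le> N g"
    using ex_min_if_finite[OF finite_imageI[OF finite_selectors] , of N K m] ne
    by (metis (no_types, lifting) finite_imageI arg_min_if_finite(1) arg_min_least finite_selectors)
  have "\<kappa>\<^sup>2 * \<delta>\<^sup>2 / 8 * real (block_distance K k g) \<le> (N g)\<^sup>2 / real n + f\<^sup>2 / 4"
    if g: "g \<in> selectors K m" for g
  proof -
    let ?\<theta> = "\<lambda>j\<in>{..<d}. block_vector d K m \<delta> k j - block_vector d K m \<delta> g j"
    have "mat_vec d X ?\<theta> = (\<lambda>i. mat_vec d X (\<lambda>j. u j - block_vector d K m \<delta> g j) i +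
        - mat_vec d X (\<lambda>j. u j - block_vector d K m \<delta> k j) i)"
      by (simp add: mat_vec_restrict fun_eq_iff mat_vec_diff)
    then have "L2_set (mat_vec d X ?\<theta>) {..<n} \<le> N g + N k"
      unfolding N_def using L2_set_triangle_ineq[of _ "\<lambda>i. - mat_vec d X (\<lambda>j. u j - block_vector d K m \<delta> k j) i"]
      by (simp only: L2_set_uminus)
    also have "\<dots> \<le> 2 * N g" using k(2)[OF g] by simp
    finally have "1 / sqrt (real n) * L2_set (mat_vec d X ?\<theta>) {..<n} \<le> 1 / sqrt (real n) * (2 * N g)"
      by (rule mult_left_mono) simp
    then have 1: "\<kappa> * L2_set ?\<theta> {..<d} \<le> 2 * (N g / sqrt (real n)) + f"
      using sep[OF k(1) g] by simp
    have "\<kappa>\<^sup>2 * \<delta>\<^sup>2 * real (block_distance K k g) \<le> (\<kappa> * L2_set ?\<theta> {..<d})\<^sup>2"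
      using mult_left_mono[OF block_vector_separation[OF k(1) g d, of \<delta>], of "\<kappa>\<^sup>2"]
      by (simp add: power_mult_distrib mult.assoc)
    also have "\<dots> \<le> (2 * (N g / sqrt (real n)) + f)\<^sup>2"
      using 1 \<kappa> by (intro power_mono) auto
    also have "\<dots> \<le> 8 * (N g / sqrt (real n))\<^sup>2 + 2 * f\<^sup>2"
      using zero_le_power2[of "2 * (N g / sqrt (real n)) - f"]
      unfolding power2_sum power2_diff power_mult_distrib by simp
    also have "(N g / sqrt (real n))\<^sup>2 = (N g)\<^sup>2 / real n"
      by (simp add: power_divide)
    finally show ?thesis by (simp add: mult.commute)
  qed
  then show ?thesis using k(1) unfolding N_def by blast
qed

text \<open>The mean of the response with block \<open>b\<close> erased. It does not depend on
  \<open>g b\<close> and is the common centre of the \<open>m\<close> candidates for that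
  block.\<close>

definition base_mean :: "nat \<Rightarrow> nat \<Rightarrow> (nat \<Rightarrow> nat \<Rightarrow> real) \<Rightarrow> real \<Rightarrow> nat \<Rightarrow> (nat \<Rightarrow> nat) \<Rightarrow> nat \<Rightarrow> real" where
  "base_mean K m X \<delta> b g i = (\<Sum>c\<in>{..<K} - {b}. X i (c * m + g c) * \<delta>)"

lemma mat_vec_block_vector_upd:
  assumes g: "g \<in> selectors K m" and d: "K * m \<le> d" and b: "b < K" and j: "j < m"
  shows "mat_vec d X (block_vector d K m \<delta> (g(b := j))) =
    (\<lambda>i. base_mean K m X \<delta> b g i + X i (b * m + j) * \<delta>)"
proof
  fix i
  have "mat_vec d X (block_vector d K m \<delta> (g(b := j))) i = (\<Sum>c<K. X i (c * m + (g(b := j)) c) * \<delta>)"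
    by (rule mat_vec_block_vector[OF selectors_upd[OF g b j] d])
  also have "\<dots> = X i (b * m + j) * \<delta> + (\<Sum>c\<in>{..<K} - {b}. X i (c * m + (g(b := j)) c) * \<delta>)"
    using b by (subst sum.remove[of _ b]) auto
  also have "(\<Sum>c\<in>{..<K} - {b}. X i (c * m + (g(b := j)) c) * \<delta>) = base_mean K m X \<delta> b g i"
    unfolding base_mean_def by (intro sum.cong) auto
  finally show "mat_vec d X (block_vector d K m \<delta> (g(b := j))) i =
      base_mean K m X \<delta> b g i + X i (b * m + j) * \<delta>" by (simp only: add.commute)
qed

text \<open>With all blocks but \<open>b\<close> frozen, selecting block \<open>b\<close> is a test
  between \<open>m\<close> means around \<open>base_mean\<close>; the column bound keeps the
  second-moment factor below \<open>exp (ln m / 2) = sqrt m\<close>. Resampling block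
  \<open>b\<close> then returns to sums over all selectors and produces the factor \<open>m\<close>.
  The selector \<open>k\<close> is arbitrary and absent from \<open>D\<close>, so it may vary with
  \<open>y\<close> in any way.\<close>

lemma selection_error_pointwise:
  fixes y :: "nat \<Rightarrow> real"
  assumes \<sigma>: "0 < \<sigma>" and m: "1 \<le> m" and d: "K * m \<le> d" and t: "0 < t"
    and col: "\<And>j. j < d \<Longrightarrow> \<delta>\<^sup>2 * (\<Sum>i<n. (X i j)\<^sup>2) \<le> \<sigma>\<^sup>2 * ln (real m) / 2"
  defines "p \<equiv> \<lambda>g. gauss_dens n \<sigma> (mat_vec d X (block_vector d K m \<delta> g)) y"
  defines "D \<equiv> \<lambda>b g. t / 2 * sqrt (real m) *
      (\<Sum>j<m. gauss_dens n \<sigma> (\<lambda>i. base_mean K m X \<delta> b g i + 2 * (X i (b * m + j) * \<delta>)) y) +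
      gauss_dens n \<sigma> (base_mean K m X \<delta> b g) y / (2 * t)"
  shows "real m * (real K * (\<Sum>g\<in>selectors K m. p g)) \<le>
    real m * (\<Sum>g\<in>selectors K m. p g * real (block_distance K k g)) + (\<Sum>b<K. \<Sum>g\<in>selectors K m. D b g)"
proof -
  have step: "real m * (\<Sum>g\<in>selectors K m. p g) \<le>
      real m * (\<Sum>g\<in>selectors K m. p g * of_bool (k b \<noteq> g b)) + (\<Sum>g\<in>selectors K m. D b g)"
    if b: "b < K" for b
  proof -
    have "(\<Sum>j<m. p (g(b := j))) \<le> (\<Sum>j<m. p (g(b := j)) * of_bool (k b \<noteq> (g(b := j)) b)) + D b g"
      if g: "g \<in> selectors K m" for g
    proof -
      have "(p (g(b := j)))\<^sup>2 \<le> sqrt (real m) * gauss_dens n \<sigma> (base_mean K m X \<delta> b g) y *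
          gauss_dens n \<sigma> (\<lambda>i. base_mean K m X \<delta> b g i + 2 * (X i (b * m + j) * \<delta>)) y" if j: "j < m" for j
      proof -
        have "(\<Sum>i<n. (X i (b * m + j) * \<delta>)\<^sup>2) = \<delta>\<^sup>2 * (\<Sum>i<n. (X i (b * m + j))\<^sup>2)"
          by (simp add: power_mult_distrib sum_distrib_left mult.commute)
        also have "\<dots> \<le> \<sigma>\<^sup>2 * ln (real m) / 2"
          using block_index_less[OF b j] d by (intro col) simp
        finally have "(\<Sum>i<n. (X i (b * m + j) * \<delta>)\<^sup>2) / \<sigma>\<^sup>2 \<le> ln (real m) / 2"
          using \<sigma> by (simp add: divide_simps mult.commute)
        then have "exp ((\<Sum>i<n. (X i (b * m + j) * \<delta>)\<^sup>2) / \<sigma>\<^sup>2) \<le> exp (ln (real m) / 2)" by simp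
        also have "\<dots> = sqrt (real m)" using m by (simp add: ln_sqrt[symmetric])
        finally show ?thesis
          unfolding p_def mat_vec_block_vector_upd[OF g d b j] gauss_dens_square
          by (intro mult_right_mono gauss_dens_nonneg)
      qed
      \<comment> \<open>Here \<open>E\<close> is \<open>sqrt m\<close>, \<open>r\<close> is the
        density at the centre, and \<open>q j\<close> is the density at the doubled shift.\<close>
      from many_hypotheses_pointwise[where p = "\<lambda>j. p (g(b := j))" and k = "k b", OF this _ gauss_dens_pos[OF \<sigma>] _ _ t]
      show ?thesis
        unfolding D_def by (simp add: p_def gauss_dens_nonneg)
    qed
    then have "(\<Sum>g\<in>selectors K m. \<Sum>j<m. p (g(b := j))) \<le>
        (\<Sum>g\<in>selectors K m. (\<Sum>j<m. p (g(b := j)) * of_bool (k b \<noteq> (g(b := j)) b)) + D b g)"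
      by (rule sum_mono)
    then show ?thesis
      unfolding sum.distrib sum_selectors_resample[OF b, where F = p]
        sum_selectors_resample[OF b, where F = "\<lambda>g. p g * of_bool (k b \<noteq> g b)"] .
  qed
  have "real m * (real K * (\<Sum>g\<in>selectors K m. p g)) = (\<Sum>b<K. real m * (\<Sum>g\<in>selectors K m. p g))"
    by simp
  also have "\<dots> \<le> (\<Sum>b<K. real m * (\<Sum>g\<in>selectors K m. p g * of_bool (k b \<noteq> g b)) + (\<Sum>g\<in>selectors K m. D b g))"
    by (intro sum_mono step) simp
  also have "\<dots> = real m * (\<Sum>b<K. \<Sum>g\<in>selectors K m. p g * of_bool (k b \<noteq> g b)) + (\<Sum>b<K. \<Sum>g\<in>selectors K m. D b g)"
    by (simp only: sum.distrib sum_distrib_left)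
  also have "(\<Sum>b<K. \<Sum>g\<in>selectors K m. p g * of_bool (k b \<noteq> g b)) =
      (\<Sum>g\<in>selectors K m. p g * real (block_distance K k g))"
    unfolding block_distance_def of_nat_sum of_nat_of_bool sum_distrib_left by (rule sum.swap)
  finally show ?thesis .
qed

section \<open>Bayes risk under the uniform prior on block vectors\<close>

lemma prediction_risk_density:
  assumes \<sigma>: "0 < \<sigma>" and est: "est \<in> estimators n d"
  shows "prediction_risk n d \<sigma> X est \<beta> = (\<integral>\<^sup>+y. ennreal (gauss_dens n \<sigma> (mat_vec d X \<beta>) y *
    ((L2_set (mat_vec d X (\<lambda>j. est y j - \<beta> j)) {..<n})\<^sup>2 / real n)) \<partial>leb n)"
    and "(\<lambda>y. (L2_set (mat_vec d X (\<lambda>j. est y j - \<beta> j)) {..<n})\<^sup>2 / real n) \<in> borel_measurable (leb n)"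
proof -
  have "(\<lambda>y. est y j) \<in> borel_measurable (Pi\<^sub>M {..<n} (\<lambda>_. borel))" if "j < d" for j
    using est measurable_component_singleton[of j "{..<d}" "\<lambda>_. borel"] that
    unfolding estimators_def by (auto intro: measurable_compose)
  then have meas [measurable]: "(\<lambda>y. (L2_set (mat_vec d X (\<lambda>j. est y j - \<beta> j)) {..<n})\<^sup>2 / real n)
      \<in> borel_measurable (Pi\<^sub>M {..<n} (\<lambda>_. borel))"
    unfolding L2_set_squared mat_vec_def
    by (intro borel_measurable_divide borel_measurable_sum borel_measurable_power borel_measurable_times
      borel_measurable_diff borel_measurable_const) auto
  then show "(\<lambda>y. (L2_set (mat_vec d X (\<lambda>j. est y j - \<beta> j)) {..<n})\<^sup>2 / real n) \<in> borel_measurable (leb n)"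
    by (rule measurable_leb)
  show "prediction_risk n d \<sigma> X est \<beta> = (\<integral>\<^sup>+y. ennreal (gauss_dens n \<sigma> (mat_vec d X \<beta>) y *
      ((L2_set (mat_vec d X (\<lambda>j. est y j - \<beta> j)) {..<n})\<^sup>2 / real n)) \<partial>leb n)"
    unfolding prediction_risk_def response_def
    by (subst nn_integral_gaussian_response[OF \<sigma>, where F = "\<lambda>y. ennreal ((L2_set (mat_vec d X (\<lambda>j. est y j - \<beta> j)) {..<n})\<^sup>2 / real n)"])
      (simp_all add: ennreal_mult gauss_dens_nonneg del: times_divide_eq_right)
qed

lemma nn_integral_has_bochner_integral:
  assumes "has_bochner_integral M f x" "\<And>y. 0 \<le> f y"
  shows "(\<integral>\<^sup>+y. ennreal (f y) \<partial>M) = ennreal x"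
  using assms nn_integral_eq_integral[of M f] by (auto simp: has_bochner_integral_iff)

text \<open>The ratio \<open>x powr (-1/4)\<close> is largest at \<open>x = 2\<close>, and
  \<open>(8/7) ^ 4 = 4096/2401 \<le> 2\<close>. This leaves each block an error probability of at
  least 1/8.\<close>

lemma powr_quarter_bound:
  fixes x :: real
  assumes "2 \<le> x"
  shows "x powr (3/4) \<le> 7/8 * x"
proof -
  have "1 / x powr (1/4) \<le> 1 / 2 powr (1/4)"
    using assms by (intro divide_left_mono powr_mono2 mult_pos_pos) auto
  also have "\<dots> \<le> 7/8"
  proof -
    have "(8/7::real) = ((8/7) ^ 4) powr (1/4)" by (simp add: powr_numeral[symmetric] powr_powr del: powr_numeral)
    also have "\<dots> \<le> 2 powr (1/4)" by (intro powr_mono2) (auto simp: power_divide)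
    finally show ?thesis by (simp add: field_simps)
  qed
  finally have "x * (1 / x powr (1/4)) \<le> x * (7/8)"
    using assms by (intro mult_left_mono) auto
  moreover have "x powr (3/4) = x powr (1 - 1/4)" by simp
  ultimately show ?thesis using assms by (simp only: powr_diff) simp
qed

text \<open>The worst case over \<open>B\<close> dominates the average over the uniform prior, and
  the pointwise inequalities integrate to a lower bound for that average. The constant 64 is 8 from
  \<open>nearest_selector\<close> times 8 from the error probability of a block.\<close>

lemma minimax_block_lower_bound:
  assumes n: "1 \<le> n" and \<sigma>: "0 < \<sigma>" and m: "2 \<le> m" and d: "K * m \<le> d" and \<kappa>: "0 \<le> \<kappa>"
    and col: "\<And>j. j < d \<Longrightarrow> \<delta>\<^sup>2 * (\<Sum>i<n. (X i j)\<^sup>2) \<le> \<sigma>\<^sup>2 * ln (real m) / 2"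
    and sep: "\<And>g h. g \<in> selectors K m \<Longrightarrow> h \<in> selectors K m \<Longrightarrow>
      \<kappa> * L2_set (\<lambda>j\<in>{..<d}. block_vector d K m \<delta> g j - block_vector d K m \<delta> h j) {..<d} - f \<le>
      1 / sqrt (real n) * L2_set (mat_vec d X (\<lambda>j\<in>{..<d}. block_vector d K m \<delta> g j - block_vector d K m \<delta> h j)) {..<n}"
    and B: "\<And>g. g \<in> selectors K m \<Longrightarrow> block_vector d K m \<delta> g \<in> B"
  shows "ennreal (real K * \<kappa>\<^sup>2 * \<delta>\<^sup>2 / 64 - f\<^sup>2 / 4) \<le> minimax_prediction_risk n d \<sigma> X B"
  unfolding minimax_prediction_risk_def
proof (rule INF_greatest)
  fix est assume est: "est \<in> estimators n d"
  define G where "G = selectors K m"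
  define N where "N = real (card G)"
  define C where "C = \<kappa>\<^sup>2 * \<delta>\<^sup>2 / 8"
  \<comment> \<open>This value balances the two terms of \<open>D b g\<close>: since every density
    integrates to one, each term integrates to \<open>m powr (3/4) / 2\<close>.\<close>
  define t where "t = real m powr (-3/4)"
  define p where "p g y = gauss_dens n \<sigma> (mat_vec d X (block_vector d K m \<delta> g)) y" for g y
  define l where "l g y = (L2_set (mat_vec d X (\<lambda>j. est y j - block_vector d K m \<delta> g j)) {..<n})\<^sup>2 / real n" for g y
  define D where "D b g y = t / 2 * sqrt (real m) *
      (\<Sum>j<m. gauss_dens n \<sigma> (\<lambda>i. base_mean K m X \<delta> b g i + 2 * (X i (b * m + j) * \<delta>)) y) +
      gauss_dens n \<sigma> (base_mean K m X \<delta> b g) y / (2 * t)" for b g y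
  have mpos: "0 < real m" and t: "0 < t" using m by (auto simp: t_def)
  have N: "0 < N" using m card_selectors_pos[of m K] by (simp add: N_def G_def)
  have C: "0 \<le> C" by (simp add: C_def)
  have p0: "0 \<le> p g y" for g y by (simp add: p_def gauss_dens_nonneg)
  have l0: "0 \<le> l g y" for g y by (simp add: l_def)
  have l_meas [measurable]: "l g \<in> borel_measurable (leb n)" for g
    unfolding l_def[abs_def] by (rule prediction_risk_density(2)[OF \<sigma> est])
  have p_meas [measurable]: "p g \<in> borel_measurable (leb n)" for g
    unfolding p_def[abs_def] by simp
  have D0: "0 \<le> D b g y" for b g y
    unfolding D_def using t by (intro add_nonneg_nonneg mult_nonneg_nonneg sum_nonneg divide_nonneg_nonneg) (auto simp: gauss_dens_nonneg)
  \<comment> \<open>Stated without subtraction and with nonnegative terms only, so that both sides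
    can be integrated in \<open>ennreal\<close>. The choice of \<open>k\<close> for each
    \<open>y\<close> has already disappeared, which leaves no measurability question.\<close>
  have pointwise: "C * (real m * (real K * (\<Sum>g\<in>G. p g y))) \<le>
      real m * (\<Sum>g\<in>G. p g y * l g y) + (real m * (f\<^sup>2 / 4) * (\<Sum>g\<in>G. p g y) + C * (\<Sum>b<K. \<Sum>g\<in>G. D b g y))" for y
  proof -
    obtain k where k: "k \<in> G" "\<And>g. g \<in> G \<Longrightarrow> C * real (block_distance K k g) \<le> l g y + f\<^sup>2 / 4"
      using nearest_selector[OF n _ d \<kappa> sep, where u = "est y"] m unfolding G_def C_def l_def by auto
    have "real m * (real K * (\<Sum>g\<in>G. p g y)) \<le>
        real m * (\<Sum>g\<in>G. p g y * real (block_distance K k g)) + (\<Sum>b<K. \<Sum>g\<in>G. D b g y)"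
      using m unfolding G_def p_def D_def by (intro selection_error_pointwise[OF \<sigma> _ d t col]) auto
    from mult_left_mono[OF this C]
    have "C * (real m * (real K * (\<Sum>g\<in>G. p g y))) \<le>
        real m * (\<Sum>g\<in>G. p g y * (C * real (block_distance K k g))) + C * (\<Sum>b<K. \<Sum>g\<in>G. D b g y)"
      by (simp add: sum_distrib_left algebra_simps)
    also have "\<dots> \<le> real m * (\<Sum>g\<in>G. p g y * (l g y + f\<^sup>2 / 4)) + C * (\<Sum>b<K. \<Sum>g\<in>G. D b g y)"
      using k(2) by (intro add_right_mono mult_left_mono sum_mono p0) auto
    also have "(\<Sum>g\<in>G. p g y * (l g y + f\<^sup>2 / 4)) = (\<Sum>g\<in>G. p g y * l g y) + f\<^sup>2 / 4 * (\<Sum>g\<in>G. p g y)"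
      by (simp add: distrib_left sum.distrib sum_distrib_left mult.commute)
    finally show ?thesis by (simp add: algebra_simps)
  qed
  have p_int: "has_bochner_integral (leb n) (p g) 1" for g
    unfolding p_def[abs_def] by (rule has_bochner_integral_gauss_dens[OF \<sigma>])
  have sum_p: "has_bochner_integral (leb n) (\<lambda>y. \<Sum>g\<in>G. p g y) N"
    using has_bochner_integral_sum[of G "leb n" p "\<lambda>_. 1", OF p_int] by (simp add: N_def)
  have D_int: "has_bochner_integral (leb n) (D b g) (real m powr (3/4))" for b g
  proof -
    have "has_bochner_integral (leb n) (D b g) (t / 2 * sqrt (real m) * (\<Sum>j<m. 1) + 1 / (2 * t))"
      unfolding D_def[abs_def]
      by (intro has_bochner_integral_add has_bochner_integral_mult_right has_bochner_integral_sum
        has_bochner_integral_divide_zero has_bochner_integral_gauss_dens[OF \<sigma>])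
    moreover have "t * sqrt (real m) * real m = real m powr (3/4)"
    proof -
      have "t * sqrt (real m) * real m = real m powr (-3/4) * real m powr (1/2) * real m powr 1"
        using mpos by (simp add: t_def powr_half_sqrt)
      also have "\<dots> = real m powr (3/4)" by (simp only: powr_add[symmetric]) simp
      finally show ?thesis .
    qed
    moreover have "1 / t = real m powr (3/4)"
      by (simp add: t_def powr_minus_divide)
    ultimately show ?thesis by (simp add: mult.assoc field_simps)
  qed
  have sum_D: "has_bochner_integral (leb n) (\<lambda>y. \<Sum>b<K. \<Sum>g\<in>G. D b g y) (real K * (N * real m powr (3/4)))"
    using has_bochner_integral_sum[of "{..<K}" "leb n" "\<lambda>b y. \<Sum>g\<in>G. D b g y" "\<lambda>_. N * real m powr (3/4)"]
      has_bochner_integral_sum[of G "leb n" "D _" "\<lambda>_. real m powr (3/4)", OF D_int] by (simp add: N_def)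
  have lhs: "(\<integral>\<^sup>+y. ennreal (C * (real m * (real K * (\<Sum>g\<in>G. p g y)))) \<partial>leb n) =
      ennreal (C * (real m * (real K * N)))"
    by (intro nn_integral_has_bochner_integral has_bochner_integral_mult_right sum_p)
      (auto intro!: mult_nonneg_nonneg sum_nonneg p0 C)
  define rest where "rest = real m * (f\<^sup>2 / 4) * N + C * (real K * (N * real m powr (3/4)))"
  have rest: "(\<integral>\<^sup>+y. ennreal (real m * (f\<^sup>2 / 4) * (\<Sum>g\<in>G. p g y) + C * (\<Sum>b<K. \<Sum>g\<in>G. D b g y)) \<partial>leb n) =
      ennreal rest"
    unfolding rest_def
    by (intro nn_integral_has_bochner_integral has_bochner_integral_add has_bochner_integral_mult_right sum_p sum_D)
      (auto intro!: mult_nonneg_nonneg add_nonneg_nonneg sum_nonneg p0 D0 C)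
  define S where "S = (SUP \<beta>\<in>B. prediction_risk n d \<sigma> X est \<beta>)"
  have risk: "(\<integral>\<^sup>+y. ennreal (p g y * l g y) \<partial>leb n) \<le> S" if "g \<in> G" for g
  proof -
    have "prediction_risk n d \<sigma> X est (block_vector d K m \<delta> g) \<le> S"
      unfolding S_def using B that by (intro SUP_upper) (auto simp: G_def)
    then show ?thesis
      unfolding prediction_risk_density(1)[OF \<sigma> est] p_def l_def .
  qed
  have "(\<integral>\<^sup>+y. ennreal (real m * (\<Sum>g\<in>G. p g y * l g y)) \<partial>leb n) =
      (\<integral>\<^sup>+y. ennreal (real m) * (\<Sum>g\<in>G. ennreal (p g y * l g y)) \<partial>leb n)"
    by (intro nn_integral_cong) (simp add: ennreal_mult sum_nonneg p0 l0 sum_ennreal[symmetric])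
  also have "\<dots> = ennreal (real m) * (\<Sum>g\<in>G. (\<integral>\<^sup>+y. ennreal (p g y * l g y) \<partial>leb n))"
    by (subst nn_integral_cmult) (auto simp: nn_integral_sum)
  also have "\<dots> \<le> ennreal (real m) * (\<Sum>g\<in>G. S)"
    by (intro mult_left_mono sum_mono risk) auto
  also have "\<dots> = ennreal (real m) * (ennreal N * S)"
    by (simp add: N_def ennreal_of_nat_eq_real_of_nat)
  finally have loss: "(\<integral>\<^sup>+y. ennreal (real m * (\<Sum>g\<in>G. p g y * l g y)) \<partial>leb n) \<le>
      ennreal (real m) * (ennreal N * S)" .
  have "ennreal (C * (real m * (real K * N))) \<le> (\<integral>\<^sup>+y. ennreal (real m * (\<Sum>g\<in>G. p g y * l g y)) +
      ennreal (real m * (f\<^sup>2 / 4) * (\<Sum>g\<in>G. p g y) + C * (\<Sum>b<K. \<Sum>g\<in>G. D b g y)) \<partial>leb n)"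
    unfolding lhs[symmetric]
  proof (intro nn_integral_mono)
    fix y
    show "ennreal (C * (real m * (real K * (\<Sum>g\<in>G. p g y)))) \<le> ennreal (real m * (\<Sum>g\<in>G. p g y * l g y)) +
        ennreal (real m * (f\<^sup>2 / 4) * (\<Sum>g\<in>G. p g y) + C * (\<Sum>b<K. \<Sum>g\<in>G. D b g y))"
      by (subst ennreal_plus[symmetric])
        (use pointwise[of y] in \<open>auto intro!: ennreal_leI mult_nonneg_nonneg add_nonneg_nonneg sum_nonneg p0 l0 D0 C\<close>)
  qed
  also have "\<dots> = (\<integral>\<^sup>+y. ennreal (real m * (\<Sum>g\<in>G. p g y * l g y)) \<partial>leb n) + ennreal rest"
    unfolding rest[symmetric]
    using sum_p[THEN borel_measurable_has_bochner_integral] sum_D[THEN borel_measurable_has_bochner_integral]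
    by (intro nn_integral_add) auto
  also have "\<dots> \<le> ennreal (real m) * (ennreal N * S) + ennreal rest"
    by (intro add_right_mono loss)
  finally have main: "ennreal (C * (real m * (real K * N))) \<le> ennreal (real m) * (ennreal N * S) + ennreal rest" .
  have "ennreal (real K * \<kappa>\<^sup>2 * \<delta>\<^sup>2 / 64 - f\<^sup>2 / 4) \<le> S"
  \<comment> \<open>An infinite supremum satisfies the bound trivially; a finite one allows a
    passage to the reals, where \<open>rest\<close> can be subtracted.\<close>
  proof (cases S)
    case (real s)
    have rest0: "0 \<le> rest" unfolding rest_def using C N by auto
    have "C * (real m * (real K * N)) \<le> real m * (N * s) + rest"
      using main real N rest0 by (simp add: ennreal_mult[symmetric] ennreal_plus[symmetric] del: ennreal_plus)
    \<comment> \<open>The testing error takes at most 7/8 of the left-hand side, so 1/8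
      survives.\<close>
    also have "rest \<le> real m * (f\<^sup>2 / 4) * N + C * (real K * (N * (7/8 * real m)))"
      unfolding rest_def using m C N by (intro add_left_mono mult_left_mono powr_quarter_bound) auto
    finally have "(real m * N) * (C * real K / 8 - f\<^sup>2 / 4) \<le> (real m * N) * s"
      by (simp add: algebra_simps)
    then have "C * real K / 8 - f\<^sup>2 / 4 \<le> s"
      using mpos N by (simp add: mult_le_cancel_left_pos)
    then show ?thesis
      unfolding real(2) using real(1) by (intro ennreal_leI) (simp add: C_def mult_ac)
  qed simp
  then show "ennreal (real K * \<kappa>\<^sup>2 * \<delta>\<^sup>2 / 64 - f\<^sup>2 / 4) \<le> (SUP \<beta>\<in>B. prediction_risk n d \<sigma> X est \<beta>)"
    by (simp add: S_def)
qed

section \<open>Column norms, and the case \<open>q = 0\<close>\<close>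

lemma column_energy:
  assumes n: "1 \<le> n" and \<kappa>: "0 \<le> \<kappa>" and le: "1 / sqrt (real n) * L2_set (\<lambda>i. X i j) {..<n} \<le> \<kappa>"
  shows "(\<Sum>i<n. (X i j)\<^sup>2) \<le> real n * \<kappa>\<^sup>2"
proof -
  have "L2_set (\<lambda>i. X i j) {..<n} \<le> sqrt (real n) * \<kappa>"
    using le n by (simp add: field_simps)
  then have "(L2_set (\<lambda>i. X i j) {..<n})\<^sup>2 \<le> (sqrt (real n) * \<kappa>)\<^sup>2"
    by (intro power_mono) simp_all
  then show ?thesis by (simp add: L2_set_squared power_mult_distrib)
qed

lemma column_normalized_energy:
  assumes n: "1 \<le> n" and \<kappa>: "0 \<le> \<kappa>" and X: "column_normalized n d X \<kappa>" and j: "j < d"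
  shows "(\<Sum>i<n. (X i j)\<^sup>2) \<le> real n * \<kappa>\<^sup>2"
proof (rule column_energy[OF n \<kappa>])
  have "L2_set (\<lambda>i. X i j) {..<n} \<le> (MAX j\<in>{..<d}. L2_set (\<lambda>i. X i j) {..<n})"
    using j by (intro Max_ge) auto
  then have "1 / sqrt (real n) * L2_set (\<lambda>i. X i j) {..<n} \<le>
      1 / sqrt (real n) * (MAX j\<in>{..<d}. L2_set (\<lambda>i. X i j) {..<n})"
    by (rule mult_left_mono) simp
  also have "\<dots> \<le> \<kappa>" using X by (simp add: column_normalized_def)
  finally show "1 / sqrt (real n) * L2_set (\<lambda>i. X i j) {..<n} \<le> \<kappa>" .
qed

text \<open>For \<open>2 * s \<le> d\<close>, take \<open>s\<close> blocks of length
  \<open>m = d div s\<close>; then \<open>d / s \<le> m + 1 \<le> m\<^sup>2\<close> costs a factor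
  of two in the logarithm. For \<open>d < 2 * s\<close> that length would be 1, so about
  \<open>d / 2\<close> blocks of length 2 are used, and
  \<open>s * ln (d / s) \<le> d - s \<le> d / 2\<close> is still of the order of their
  number.\<close>

lemma sparse_blocks:
  fixes s d :: nat
  assumes s: "1 \<le> s" "s \<le> d" and d: "2 \<le> d"
  obtains K m where "K \<le> s" "K * m \<le> d" "2 \<le> m" "real s * ln (real d / real s) \<le> 3 * (real K * ln (real m))"
proof (cases "2 * s \<le> d")
  case True
  define m where "m = d div s"
  have m: "2 \<le> m" unfolding m_def using True s by (simp add: less_eq_div_iff_mult_less_eq)
  have "d < (m + 1) * s" unfolding m_def using s
    using dividend_less_div_times[of s d] by simp
  then have "real d < real (m + 1) * real s" by (metis of_nat_less_iff of_nat_mult)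
  then have "real d / real s \<le> real m + 1" using s by (simp add: field_simps)
  also have "real m + 1 \<le> (real m)\<^sup>2"
  proof -
    have "2 * real m \<le> real m * real m" using m by (intro mult_right_mono) auto
    moreover have "real m + 1 \<le> 2 * real m" using m by simp
    ultimately show ?thesis unfolding power2_eq_square by linarith
  qed
  finally have "ln (real d / real s) \<le> ln ((real m)\<^sup>2)"
    using s d m by (intro ln_mono) auto
  also have "\<dots> \<le> 3 * ln (real m)" using m by (simp add: ln_realpow)
  finally have "real s * ln (real d / real s) \<le> real s * (3 * ln (real m))"
    by (rule mult_left_mono) simp
  then show ?thesis using m by (intro that[of s m]) (auto simp: m_def)
next
  case False
  define K where "K = d div 2"
  \<comment> \<open>The constant 3 is forced by \<open>d = 3\<close>, where
    \<open>K = 1\<close>.\<close>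
  have "d \<le> 3 * K" using d unfolding K_def by presburger
  then have K: "real d \<le> 3 * real K" by linarith
  have "real s * ln (real d / real s) \<le> real s * (real d / real s - 1)"
    using s d by (intro mult_left_mono ln_le_minus_one) auto
  also have "\<dots> = real d - real s" using s by (simp add: field_simps)
  also have "\<dots> \<le> real d / 2" using False by simp
  also have "\<dots> \<le> 3 * (real K * (1/2))" using K by simp
  also have "\<dots> \<le> 3 * (real K * ln 2)"
    using ln2_ge_two_thirds by (intro mult_left_mono) auto
  finally show ?thesis using False by (intro that[of K 2]) (auto simp: K_def)
qed

lemma restrict_mem_l0_ball:
  assumes "(\<Sum>j<d. of_bool (u j \<noteq> 0)) \<le> s"
  shows "restrict u {..<d} \<in> l0_ball d s"
proof -
  have "(\<Sum>j<d. of_bool (restrict u {..<d} j \<noteq> 0)) = (\<Sum>j<d. of_bool (u j \<noteq> 0) :: nat)"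
    by (rule sum.cong) auto
  moreover have "restrict u {..<d} \<in> {..<d} \<rightarrow>\<^sub>E UNIV" by simp
  ultimately show ?thesis using assms unfolding l0_ball_def mem_Collect_eq by metis
qed

lemma sum_of_bool_block_vector:
  assumes "g \<in> selectors K m" "K * m \<le> d"
  shows "(\<Sum>j<d. of_bool (block_vector d K m \<delta> g j \<noteq> 0)) \<le> K"
proof -
  have "(\<Sum>j<d. of_bool (block_vector d K m \<delta> g j \<noteq> 0)) = (\<Sum>b<K. of_bool (\<delta> \<noteq> 0) :: nat)"
    by (rule sum_block_vector[OF assms, of "\<lambda>_ x. of_bool (x \<noteq> 0)"]) simp
  then show ?thesis by simp
qed

text \<open>The block bound with \<open>f = 0\<close> and the largest \<delta> that the column
  condition admits when columns are bounded through \<open>\<kappa>\<^sub>u\<close>. The constant is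
  \<open>384 = 64 * 2 * 3\<close>: the block bound, the 2 in \<open>\<delta>\<^sup>2\<close>, and
  the 3 from \<open>sparse_blocks\<close>.\<close>

lemma sparse_minimax:
  assumes n: "1 \<le> n" and s: "1 \<le> s" "s \<le> d" and \<sigma>: "0 < \<sigma>" and \<kappa>: "0 < \<kappa>\<^sub>l" "0 < \<kappa>\<^sub>u"
    and RE: "\<And>\<theta>. \<theta> \<in> l0_ball d (2 * s) \<Longrightarrow>
      \<kappa>\<^sub>l * L2_set \<theta> {..<d} \<le> 1 / sqrt (real n) * L2_set (mat_vec d X \<theta>) {..<n} \<and>
      1 / sqrt (real n) * L2_set (mat_vec d X \<theta>) {..<n} \<le> \<kappa>\<^sub>u * L2_set \<theta> {..<d}"
  shows "ennreal (1 / 384 * \<kappa>\<^sub>l\<^sup>2 * (\<sigma>\<^sup>2 / \<kappa>\<^sub>u\<^sup>2) * (real s * ln (real d / real s) / real n)) \<le>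
    minimax_prediction_risk n d \<sigma> X (l0_ball d s)"
proof (cases "d = 1")
  \<comment> \<open>Then \<open>s = 1\<close> and the bound is zero. Blocks of length at least two
    need \<open>d \<ge> 2\<close>.\<close>
  case True
  then show ?thesis using s by simp
next
  case False
  with s have "2 \<le> d" by simp
  then obtain K m where K: "K \<le> s" and Km: "K * m \<le> d" and m: "2 \<le> m"
    and log: "real s * ln (real d / real s) \<le> 3 * (real K * ln (real m))"
    using sparse_blocks[OF s] by blast
  have lnm: "0 \<le> ln (real m)" using m by simp
  define \<delta> where "\<delta> = sqrt (\<sigma>\<^sup>2 * ln (real m) / (2 * \<kappa>\<^sub>u\<^sup>2 * real n))"
  have \<delta>: "\<delta>\<^sup>2 = \<sigma>\<^sup>2 * ln (real m) / (2 * \<kappa>\<^sub>u\<^sup>2 * real n)"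
    unfolding \<delta>_def using lnm by simp
  have "ennreal (real K * \<kappa>\<^sub>l\<^sup>2 * \<delta>\<^sup>2 / 64 - 0\<^sup>2 / 4) \<le> minimax_prediction_risk n d \<sigma> X (l0_ball d s)"
  proof (rule minimax_block_lower_bound[OF n \<sigma> m Km])
    fix j assume j: "j < d"
    \<comment> \<open>Column \<open>j\<close> is the image of a unit vector, which is sparse, so the
      upper eigenvalue bound controls its norm.\<close>
    let ?e = "\<lambda>i\<in>{..<d}. if i = j then 1 else 0 :: real"
    have "(\<Sum>i<d. of_bool ((if i = j then 1 else 0 :: real) \<noteq> 0)) = (\<Sum>i<d. if i = j then 1 else 0 :: nat)"
      by (intro sum.cong) auto
    then have e: "?e \<in> l0_ball d (2 * s)"
      using j s by (intro restrict_mem_l0_ball) simp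
    have "L2_set ?e {..<d} = sqrt (\<Sum>i<d. if i = j then 1 else 0)"
      unfolding L2_set_def by (intro arg_cong[where f = sqrt] sum.cong) auto
    then have e1: "L2_set ?e {..<d} = 1" using j by simp
    have "(\<Sum>k<d. X i k * ?e k) = (\<Sum>k<d. if k = j then X i k else 0)" for i
      by (intro sum.cong) auto
    then have "mat_vec d X ?e = (\<lambda>i. X i j)"
      unfolding mat_vec_def using j by simp
    then have "(\<Sum>i<n. (X i j)\<^sup>2) \<le> real n * \<kappa>\<^sub>u\<^sup>2"
      using RE[OF e] \<kappa> by (intro column_energy[OF n]) (simp_all add: e1)
    from mult_left_mono[OF this zero_le_power2[of \<delta>]]
    show "\<delta>\<^sup>2 * (\<Sum>i<n. (X i j)\<^sup>2) \<le> \<sigma>\<^sup>2 * ln (real m) / 2"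
      using n \<kappa> by (simp add: \<delta>)
  next
    fix g h assume g: "g \<in> selectors K m" and h: "h \<in> selectors K m"
    let ?\<theta> = "\<lambda>j\<in>{..<d}. block_vector d K m \<delta> g j - block_vector d K m \<delta> h j"
    have "(\<Sum>j<d. of_bool (block_vector d K m \<delta> g j - block_vector d K m \<delta> h j \<noteq> 0)) \<le> (\<Sum>j<d. of_bool (block_vector d K m \<delta> g j \<noteq> 0) +
        of_bool (block_vector d K m \<delta> h j \<noteq> 0) :: nat)"
      by (intro sum_mono) auto
    also have "\<dots> \<le> 2 * s"
      unfolding sum.distrib using sum_of_bool_block_vector[OF g Km, of \<delta>] sum_of_bool_block_vector[OF h Km, of \<delta>] K
      by linarith
    finally have "?\<theta> \<in> l0_ball d (2 * s)" by (rule restrict_mem_l0_ball)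
    with RE[OF this]
    show "\<kappa>\<^sub>l * L2_set ?\<theta> {..<d} - 0 \<le> 1 / sqrt (real n) * L2_set (mat_vec d X ?\<theta>) {..<n}" by simp
  next
    fix g assume g: "g \<in> selectors K m"
    show "block_vector d K m \<delta> g \<in> l0_ball d s"
      using order_trans[OF sum_of_bool_block_vector[OF g Km, of \<delta>] K] block_vector_extensional
      by (simp add: l0_ball_def)
  qed (use \<kappa> in simp)
  moreover have "1 / 384 * \<kappa>\<^sub>l\<^sup>2 * (\<sigma>\<^sup>2 / \<kappa>\<^sub>u\<^sup>2) * (real s * ln (real d / real s) / real n) \<le>
      real K * \<kappa>\<^sub>l\<^sup>2 * \<delta>\<^sup>2 / 64 - 0\<^sup>2 / 4"
  proof -
    have "1 / 384 * \<kappa>\<^sub>l\<^sup>2 * (\<sigma>\<^sup>2 / \<kappa>\<^sub>u\<^sup>2) * (real s * ln (real d / real s) / real n) \<le>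
        1 / 384 * \<kappa>\<^sub>l\<^sup>2 * (\<sigma>\<^sup>2 / \<kappa>\<^sub>u\<^sup>2) * (3 * (real K * ln (real m)) / real n)"
      by (intro mult_left_mono divide_right_mono log) auto
    also have "\<dots> = real K * \<kappa>\<^sub>l\<^sup>2 * \<delta>\<^sup>2 / 64 - 0\<^sup>2 / 4"
      unfolding \<delta> using n \<kappa> by (simp add: field_simps)
    finally show ?thesis .
  qed
  ultimately show ?thesis
    by (meson ennreal_leI order_trans)
qed

section \<open>The case \<open>0 < q \<le> 1\<close>\<close>

lemma lq_sum_block_vector:
  assumes "g \<in> selectors K m" "K * m \<le> d" "0 \<le> \<delta>"
  shows "(\<Sum>j<d. \<bar>block_vector d K m \<delta> g j\<bar> powr q) = real K * \<delta> powr q"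
  using sum_block_vector[OF assms(1,2), of "\<lambda>_ x. \<bar>x\<bar> powr q" \<delta>] assms by simp

text \<open>The bound at one fixed \<open>n\<close>, with the asymptotic conditions replaced by the
  inequalities they eventually give. Entries have \<open>\<delta>\<^sup>2 = a * B\<close>, a
  fraction of the noise level \<open>B\<close>, and the number of blocks exhausts the budget
  \<open>R\<close>. The hypothesis \<open>BR\<close> yields at least one block, the two hypotheses
  \<open>m\<close> yield blocks long enough for \<delta> to be undetectable, and the bound on
  \<open>f\<close> keeps the residual below half of the main term.\<close>

lemma lq_minimax:
  fixes a q R f \<sigma> \<kappa>\<^sub>c \<kappa>\<^sub>l :: real and n d :: nat
  defines "B \<equiv> \<sigma>\<^sup>2 / \<kappa>\<^sub>c\<^sup>2 * (ln (real d) / real n)"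
  assumes n: "1 \<le> n" and q: "0 < q" "q \<le> 1" and a: "0 < a" "a \<le> 1"
    and \<sigma>: "0 < \<sigma>" and \<kappa>: "0 < \<kappa>\<^sub>c" "0 < \<kappa>\<^sub>l" and d2: "2 \<le> d" and R: "0 < R"
    and X: "column_normalized n d X \<kappa>\<^sub>c"
    and BR: "B powr (q / 2) \<le> R"
    and m: "real d * (a * B) powr (q / 2) / R \<ge> 3"
      "exp (2 * a * ln (real d)) \<le> real d * (a * B) powr (q / 2) / R - 1"
    and f: "\<bar>f\<bar> \<le> \<kappa>\<^sub>l / 8 * (R powr (1 / 2) * (a * B) powr (1 / 2 - q / 4))"
    and RE: "\<And>\<theta>. \<theta> \<in> lq_ball d q (2 * R) \<Longrightarrow>
      \<kappa>\<^sub>l * L2_set \<theta> {..<d} - f \<le> 1 / sqrt (real n) * L2_set (mat_vec d X \<theta>) {..<n}"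
  shows "ennreal (a powr (1 - q / 2) / 256 * R * \<kappa>\<^sub>l\<^sup>2 * B powr (1 - q / 2)) \<le>
    minimax_prediction_risk n d \<sigma> X (lq_ball d q R)"
proof -
  have Bpos: "0 < B" unfolding B_def using \<sigma> \<kappa> n d2 by simp
  define A where "A = a * B"
  have A: "0 < A" using Bpos a by (simp add: A_def)
  define \<delta> where "\<delta> = sqrt A"
  have \<delta>: "0 < \<delta>" "\<delta>\<^sup>2 = A" using A by (auto simp: \<delta>_def)
  have \<delta>q: "\<delta> powr q = A powr (q / 2)"
    using A by (simp add: \<delta>_def powr_half_sqrt[symmetric] powr_powr)
  have Aq: "0 < A powr (q / 2)" using A by simp
  have "A powr (q / 2) \<le> B powr (q / 2)"
    unfolding A_def using a q Bpos by (intro powr_mono2) (auto simp: mult_le_cancel_right1)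
  then have ratio: "1 \<le> R / A powr (q / 2)" using BR Aq by (simp add: divide_simps)
  \<comment> \<open>Rounding down loses at most a factor of two because the quotient is at least
    one.\<close>
  define K where "K = nat \<lfloor>R / A powr (q / 2)\<rfloor>"
  have Kle: "real K \<le> R / A powr (q / 2)" and Kge: "R / A powr (q / 2) \<le> 2 * real K" and K1: "1 \<le> K"
  proof -
    have 1: "1 \<le> \<lfloor>R / A powr (q / 2)\<rfloor>" using ratio by (simp add: le_floor_iff)
    then show "1 \<le> K" unfolding K_def by linarith
    have "real K = real_of_int \<lfloor>R / A powr (q / 2)\<rfloor>" using 1 by (simp add: K_def)
    with 1 show "real K \<le> R / A powr (q / 2)" "R / A powr (q / 2) \<le> 2 * real K" by linarith+
  qed
  define m' where "m' = d div K"
  have Km: "K * m' \<le> d" by (simp add: m'_def)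
  have "real d / (R / A powr (q / 2)) \<le> real d / real K"
    using Kle K1 Aq R by (intro divide_left_mono) auto
  moreover have "d < (m' + 1) * K"
    unfolding m'_def using K1 dividend_less_div_times[of K d] by simp
  then have "real d < real (m' + 1) * real K" by (metis of_nat_less_iff of_nat_mult)
  then have "real d / real K \<le> real m' + 1"
    using K1 by (simp add: field_simps)
  \<comment> \<open>Rounding in \<open>d div K\<close> loses less than one; this is the
    \<open>- 1\<close> in the second hypothesis \<open>m\<close> and the reason for 3 rather than 2
    in the first.\<close>
  ultimately have m'ge: "real d * A powr (q / 2) / R - 1 \<le> real m'" by simp
  have m2: "2 \<le> m'" using m'ge m(1) unfolding A_def[symmetric] by linarith
  have "exp (2 * a * ln (real d)) \<le> real m'" using m'ge m(2) unfolding A_def[symmetric] by linarith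
  then have "2 * a * ln (real d) \<le> ln (real m')" using m2 by (simp add: ln_ge_iff)
  then have alog: "a * ln (real d) \<le> ln (real m') / 2" by simp
  have KR: "real K * \<delta> powr q \<le> R" using Kle Aq by (simp add: \<delta>q field_simps)
  have "ennreal (real K * \<kappa>\<^sub>l\<^sup>2 * \<delta>\<^sup>2 / 64 - f\<^sup>2 / 4) \<le> minimax_prediction_risk n d \<sigma> X (lq_ball d q R)"
  proof (rule minimax_block_lower_bound[OF n \<sigma> m2 Km])
    fix j assume "j < d"
    then have "\<delta>\<^sup>2 * (\<Sum>i<n. (X i j)\<^sup>2) \<le> A * (real n * \<kappa>\<^sub>c\<^sup>2)"
      unfolding \<delta>(2) using column_normalized_energy[OF n _ X] \<kappa> A by (intro mult_left_mono) auto
    also have "\<dots> = \<sigma>\<^sup>2 * (a * ln (real d))"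
      unfolding A_def B_def using n \<kappa> by (simp add: field_simps)
    also have "\<dots> \<le> \<sigma>\<^sup>2 * (ln (real m') / 2)"
      by (intro mult_left_mono alog) simp
    finally show "\<delta>\<^sup>2 * (\<Sum>i<n. (X i j)\<^sup>2) \<le> \<sigma>\<^sup>2 * ln (real m') / 2" by simp
  next
    fix g h assume g: "g \<in> selectors K m'" and h: "h \<in> selectors K m'"
    let ?\<theta> = "\<lambda>j\<in>{..<d}. block_vector d K m' \<delta> g j - block_vector d K m' \<delta> h j"
    \<comment> \<open>All entries are 0 or \<delta>, so the inequality holds entry by entry.\<close>
    have "(\<Sum>j<d. \<bar>?\<theta> j\<bar> powr q) \<le>
        (\<Sum>j<d. \<bar>block_vector d K m' \<delta> g j\<bar> powr q + \<bar>block_vector d K m' \<delta> h j\<bar> powr q)"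
      by (intro sum_mono) (auto simp: block_vector_def)
    also have "\<dots> \<le> 2 * R"
      using KR \<delta> by (simp add: sum.distrib lq_sum_block_vector[OF g Km] lq_sum_block_vector[OF h Km])
    finally have "?\<theta> \<in> lq_ball d q (2 * R)" by (simp add: lq_ball_def)
    then show "\<kappa>\<^sub>l * L2_set ?\<theta> {..<d} - f \<le> 1 / sqrt (real n) * L2_set (mat_vec d X ?\<theta>) {..<n}"
      by (rule RE)
  next
    fix g assume g: "g \<in> selectors K m'"
    show "block_vector d K m' \<delta> g \<in> lq_ball d q R"
      using KR \<delta> block_vector_extensional by (simp add: lq_ball_def lq_sum_block_vector[OF g Km])
  qed (use \<kappa> in simp)
  moreover have "a powr (1 - q / 2) / 256 * R * \<kappa>\<^sub>l\<^sup>2 * B powr (1 - q / 2) \<le>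
      real K * \<kappa>\<^sub>l\<^sup>2 * \<delta>\<^sup>2 / 64 - f\<^sup>2 / 4"
  proof -
    \<comment> \<open>The main term is at least \<open>\<kappa>\<^sub>l\<^sup>2 * P / 128\<close>
      and \<open>f\<^sup>2 / 4\<close> is at most \<open>\<kappa>\<^sub>l\<^sup>2 * P / 256\<close>,
      which leaves \<open>\<kappa>\<^sub>l\<^sup>2 * P / 256\<close>.\<close>
    define P where "P = R * A powr (1 - q / 2)"
    have "P = R / A powr (q / 2) * A" using A by (simp add: P_def powr_diff)
    also have "\<dots> \<le> 2 * real K * A" using Kge A by (intro mult_right_mono) auto
    finally have 1: "\<kappa>\<^sub>l\<^sup>2 * P \<le> \<kappa>\<^sub>l\<^sup>2 * (2 * real K * A)" by (rule mult_left_mono) simp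
    have "f\<^sup>2 \<le> (\<kappa>\<^sub>l / 8 * (R powr (1 / 2) * A powr (1 / 2 - q / 4)))\<^sup>2"
      using f power_mono[OF f, of 2] unfolding A_def by simp
    also have "\<dots> = \<kappa>\<^sub>l\<^sup>2 / 64 * P"
      using R A by (simp add: P_def power_mult_distrib power_divide powr_power)
    finally have 2: "f\<^sup>2 \<le> \<kappa>\<^sub>l\<^sup>2 / 64 * P" .
    have "a powr (1 - q / 2) / 256 * R * \<kappa>\<^sub>l\<^sup>2 * B powr (1 - q / 2) = \<kappa>\<^sub>l\<^sup>2 * P / 256"
      using a Bpos by (simp add: P_def A_def powr_mult)
    then show ?thesis using 1 2 unfolding \<delta>(2) by (simp only: mult_ac)
  qed
  ultimately show ?thesis
    by (meson ennreal_leI order_trans)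
qed

text \<open>With \<open>w = d powr (\<kappa> / 2)\<close>, the quantity
  \<open>c * d powr \<kappa>\<close> is eventually at least \<open>3 * w\<close>, while the
  exponential is at most \<open>w\<close> by the choice of \<open>a\<close>; and
  \<open>w \<le> 3 * w - 1\<close> once \<open>w \<ge> 1\<close>.\<close>

lemma block_size_growth:
  fixes \<kappa> a c e :: real
  assumes "0 < \<kappa>" "0 < c" "a \<le> \<kappa> / 8" and d: "filterlim d at_top sequentially"
  shows "\<forall>\<^sub>F n in sequentially. 3 \<le> c * real (d n) powr \<kappa> \<and>
    exp (2 * a * ln (real (d n))) \<le> c * real (d n) powr \<kappa> - 1"
proof -
  have "filterlim (\<lambda>n. real (d n) powr (\<kappa> / 2)) at_top sequentially"
    using assms by (intro filterlim_compose[OF real_powr_at_top]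
      filterlim_compose[OF filterlim_real_sequentially d]) auto
  then have "\<forall>\<^sub>F n in sequentially. max 1 (3 / c) \<le> real (d n) powr (\<kappa> / 2)"
    unfolding filterlim_at_top by blast
  moreover have "\<forall>\<^sub>F n in sequentially. 1 \<le> d n"
    using d by (simp add: filterlim_at_top)
  ultimately show ?thesis
  proof eventually_elim
    case (elim n)
    define w where "w = real (d n) powr (\<kappa> / 2)"
    have w: "1 \<le> w" "3 \<le> c * w"
      using elim assms by (auto simp: w_def field_simps)
    have "real (d n) powr \<kappa> = w * w"
      by (simp add: w_def powr_add[symmetric])
    moreover have "3 * w \<le> c * w * w"
      using w by (intro mult_right_mono) auto
    ultimately have 1: "3 * w \<le> c * real (d n) powr \<kappa>" by (simp add: mult.assoc)
    have "exp (2 * a * ln (real (d n))) \<le> exp (\<kappa> / 2 * ln (real (d n)))"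
      using assms elim by (intro exp_mono mult_right_mono) auto
    also have "\<dots> = w" using elim by (simp add: w_def powr_def)
    finally show ?case using 1 w by linarith
  qed
qed

text \<open>In the first part the scaling condition and \<open>d\<close> tending to infinity make
  the blocks long. The lower bound on \<open>R n\<close> lets one entry at the noise level
  \<open>B\<close> fit into the ball: if \<open>R powr (1/q)\<close> were of smaller order than
  \<open>sqrt B\<close>, the zero estimator, whose risk is at most
  \<open>\<kappa>\<^sub>c\<^sup>2 * R powr (2/q)\<close>, would beat the claimed rate. The second
  part is \<open>sparse_minimax\<close>.\<close>

theorem theorem3:
  "(\<forall>q \<kappa> :: real. 0 < q \<longrightarrow> q \<le> 1 \<longrightarrow> 0 < \<kappa> \<longrightarrow>
     (\<exists>c>0. \<forall>(\<sigma> :: real) (\<kappa>\<^sub>c :: real) (\<kappa>\<^sub>l :: real)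
         (d :: nat \<Rightarrow> nat) (R :: nat \<Rightarrow> real) (X :: nat \<Rightarrow> nat \<Rightarrow> nat \<Rightarrow> real)
         (f :: real \<Rightarrow> nat \<Rightarrow> nat \<Rightarrow> real).
        0 < \<sigma> \<longrightarrow> 0 < \<kappa>\<^sub>c \<longrightarrow> 0 < \<kappa>\<^sub>l \<longrightarrow>
        (\<forall>n\<ge>1. 1 \<le> d n \<and> 0 < R n \<and> column_normalized n (d n) (X n) \<kappa>\<^sub>c) \<longrightarrow>
        (\<lambda>n. real (d n) / (R n * real n powr (q / 2))) \<in> \<Omega>(\<lambda>n. real (d n) powr \<kappa>) \<longrightarrow>
        filterlim d at_top sequentially \<longrightarrow>
        (\<forall>\<^sub>F n in sequentially. (\<sigma>\<^sup>2 / \<kappa>\<^sub>c\<^sup>2 * (ln (real (d n)) / real n)) powr (q / 2) \<le> R n) \<longrightarrow>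
        (\<lambda>n. f (R n) n (d n)) \<in>
          o(\<lambda>n. R n powr (1 / 2) * (ln (real (d n)) / real n) powr (1 / 2 - q / 4)) \<longrightarrow>
        (\<forall>n\<ge>1. \<forall>\<theta>\<in>lq_ball (d n) q (2 * R n).
           1 / sqrt (real n) * L2_set (mat_vec (d n) (X n) \<theta>) {..<n}
             \<ge> \<kappa>\<^sub>l * L2_set \<theta> {..<d n} - f (R n) n (d n)) \<longrightarrow>
        (\<forall>\<^sub>F n in sequentially.
           minimax_prediction_risk n (d n) \<sigma> (X n) (lq_ball (d n) q (R n))
             \<ge> ennreal (c * R n * \<kappa>\<^sub>l\<^sup>2 *
                 (\<sigma>\<^sup>2 / \<kappa>\<^sub>c\<^sup>2 * (ln (real (d n)) / real n)) powr (1 - q / 2)))))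
   \<and>
   (\<exists>c>0. \<forall>(n :: nat) (d :: nat) (s :: nat) (\<sigma> :: real) (\<kappa>\<^sub>c :: real) (\<kappa>\<^sub>l :: real) (\<kappa>\<^sub>u :: real)
        (X :: nat \<Rightarrow> nat \<Rightarrow> real).
      1 \<le> n \<longrightarrow> 1 \<le> s \<longrightarrow> s \<le> d \<longrightarrow> 0 < \<sigma> \<longrightarrow> 0 < \<kappa>\<^sub>c \<longrightarrow> 0 < \<kappa>\<^sub>l \<longrightarrow> 0 < \<kappa>\<^sub>u \<longrightarrow>
      column_normalized n d X \<kappa>\<^sub>c \<longrightarrow>
      (\<forall>\<theta>\<in>l0_ball d (2 * s).
         \<kappa>\<^sub>l * L2_set \<theta> {..<d} \<le> 1 / sqrt (real n) * L2_set (mat_vec d X \<theta>) {..<n} \<and>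
         1 / sqrt (real n) * L2_set (mat_vec d X \<theta>) {..<n} \<le> \<kappa>\<^sub>u * L2_set \<theta> {..<d}) \<longrightarrow>
      minimax_prediction_risk n d \<sigma> X (l0_ball d s)
        \<ge> ennreal (c * \<kappa>\<^sub>l\<^sup>2 * (\<sigma>\<^sup>2 / \<kappa>\<^sub>u\<^sup>2) * (real s * ln (real d / real s) / real n)))"
proof (intro conjI allI impI, goal_cases)
  case (1 q \<kappa>)
  then have q: "0 < q" "q \<le> 1" and \<kappa>: "0 < \<kappa>" by auto
  \<comment> \<open>The bound \<open>\<kappa> / 8\<close> serves \<open>block_size_growth\<close>,
    and the bound 1 keeps \<open>a * B\<close> below \<open>B\<close>. Only \<kappa> enters, so the
    final constant depends on \<open>q\<close> and \<kappa> alone.\<close>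
  define a where "a = min 1 (\<kappa> / 8)"
  have a: "0 < a" "a \<le> 1" "a \<le> \<kappa> / 8" using \<kappa> by (auto simp: a_def)
  show ?case
  proof (intro exI[of _ "a powr (1 - q / 2) / 256"] conjI allI impI)
    show "0 < a powr (1 - q / 2) / 256" using a by simp
  next
    fix \<sigma> \<kappa>\<^sub>c \<kappa>\<^sub>l :: real and d :: "nat \<Rightarrow> nat" and R :: "nat \<Rightarrow> real"
      and X :: "nat \<Rightarrow> nat \<Rightarrow> nat \<Rightarrow> real" and f :: "real \<Rightarrow> nat \<Rightarrow> nat \<Rightarrow> real"
    assume pos: "0 < \<sigma>" "0 < \<kappa>\<^sub>c" "0 < \<kappa>\<^sub>l"
      and inst: "\<forall>n\<ge>1. 1 \<le> d n \<and> 0 < R n \<and> column_normalized n (d n) (X n) \<kappa>\<^sub>c"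
      and Omega: "(\<lambda>n. real (d n) / (R n * real n powr (q / 2))) \<in> \<Omega>(\<lambda>n. real (d n) powr \<kappa>)"
      and d: "filterlim d at_top sequentially"
      and BR: "\<forall>\<^sub>F n in sequentially. (\<sigma>\<^sup>2 / \<kappa>\<^sub>c\<^sup>2 * (ln (real (d n)) / real n)) powr (q / 2) \<le> R n"
      and f: "(\<lambda>n. f (R n) n (d n)) \<in>
          o(\<lambda>n. R n powr (1 / 2) * (ln (real (d n)) / real n) powr (1 / 2 - q / 4))"
      and RE: "\<forall>n\<ge>1. \<forall>\<theta>\<in>lq_ball (d n) q (2 * R n).
           1 / sqrt (real n) * L2_set (mat_vec (d n) (X n) \<theta>) {..<n}
             \<ge> \<kappa>\<^sub>l * L2_set \<theta> {..<d n} - f (R n) n (d n)"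
    define b where "b = a * (\<sigma>\<^sup>2 / \<kappa>\<^sub>c\<^sup>2)"
    have b: "0 < b" using a pos by (simp add: b_def)
    obtain c where c: "0 < c" and
      Omega': "\<forall>\<^sub>F n in sequentially. c * norm (real (d n) powr \<kappa>) \<le> norm (real (d n) / (R n * real n powr (q / 2)))"
      using landau_omega.bigE[OF Omega] by blast
    \<comment> \<open>The constant for the small-o bound absorbs the passage from
      \<open>ln d / n\<close> to \<open>a * B\<close>. It may involve \<sigma> and
      \<open>\<kappa>\<^sub>c\<close>, fixed along the sequence, since it affects only how large
      \<open>n\<close> must be.\<close>
    have f': "\<forall>\<^sub>F n in sequentially. norm (f (R n) n (d n)) \<le>
        \<kappa>\<^sub>l / 8 * b powr (1 / 2 - q / 4) * norm (R n powr (1 / 2) * (ln (real (d n)) / real n) powr (1 / 2 - q / 4))"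
      using pos b by (intro landau_o.smallD[OF f]) auto
    have "0 < c * b powr (q / 2)" using b c by simp
    note growth = block_size_growth[OF \<kappa> this a(3) d]
    have d3: "\<forall>\<^sub>F n in sequentially. 3 \<le> d n"
      using d by (simp add: filterlim_at_top)
    show "\<forall>\<^sub>F n in sequentially.
        minimax_prediction_risk n (d n) \<sigma> (X n) (lq_ball (d n) q (R n))
          \<ge> ennreal (a powr (1 - q / 2) / 256 * R n * \<kappa>\<^sub>l\<^sup>2 *
              (\<sigma>\<^sup>2 / \<kappa>\<^sub>c\<^sup>2 * (ln (real (d n)) / real n)) powr (1 - q / 2))"
      using Omega' f' growth d3 BR eventually_ge_at_top[of 1]
    proof eventually_elim
      case (elim n)
      have R: "0 < R n" and X: "column_normalized n (d n) (X n) \<kappa>\<^sub>c" using inst elim(6) by auto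
      \<comment> \<open>The logarithm is at least one because \<open>d n \<ge> 3\<close>, so the
        factor \<open>ln (d n) powr (q / 2)\<close>, absent from the scaling condition, can be
        inserted on the larger side.\<close>
      have "exp 1 \<le> real (d n)" using exp_le elim(4) by linarith
      then have ln1: "1 \<le> ln (real (d n))" using elim(4) by (simp add: ln_ge_iff)
      have split: "(a * (\<sigma>\<^sup>2 / \<kappa>\<^sub>c\<^sup>2 * (ln (real (d n)) / real n))) powr r = b powr r * (ln (real (d n)) / real n) powr r" for r
        unfolding b_def mult.assoc[symmetric] using ln1 b by (subst powr_mult) (auto simp: b_def)
      have "c * b powr (q / 2) * real (d n) powr \<kappa> \<le> real (d n) / (R n * real n powr (q / 2)) * b powr (q / 2)"
        using mult_right_mono[OF elim(1), of "b powr (q / 2)"] R by (simp add: mult_ac)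
      also have "\<dots> \<le> real (d n) / (R n * real n powr (q / 2)) * b powr (q / 2) * ln (real (d n)) powr (q / 2)"
        using mult_left_mono[OF ge_one_powr_ge_zero[OF ln1, of "q / 2"],
            of "real (d n) / (R n * real n powr (q / 2)) * b powr (q / 2)"] q R by simp
      also have "\<dots> = real (d n) * (a * (\<sigma>\<^sup>2 / \<kappa>\<^sub>c\<^sup>2 * (ln (real (d n)) / real n))) powr (q / 2) / R n"
        unfolding split using ln1 by (simp add: powr_divide mult_ac)
      finally have T: "c * b powr (q / 2) * real (d n) powr \<kappa> \<le>
          real (d n) * (a * (\<sigma>\<^sup>2 / \<kappa>\<^sub>c\<^sup>2 * (ln (real (d n)) / real n))) powr (q / 2) / R n" .
      show ?case
      proof (rule lq_minimax[OF elim(6) q a(1,2) pos _ R X elim(5)])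
        show "\<bar>f (R n) n (d n)\<bar> \<le> \<kappa>\<^sub>l / 8 * (R n powr (1 / 2) *
            (a * (\<sigma>\<^sup>2 / \<kappa>\<^sub>c\<^sup>2 * (ln (real (d n)) / real n))) powr (1 / 2 - q / 4))"
          unfolding split using elim(2) by (simp add: abs_mult mult_ac)
      qed (use elim(3,4,6) T RE in auto)
    qed
  qed
next
  case 2
  show ?case
  proof (intro exI[of _ "1 / 384"] conjI allI impI)
    fix n d s :: nat and \<sigma> \<kappa>\<^sub>c \<kappa>\<^sub>l \<kappa>\<^sub>u :: real and X :: "nat \<Rightarrow> nat \<Rightarrow> real"
    assume "1 \<le> n" "1 \<le> s" "s \<le> d" "0 < \<sigma>" "0 < \<kappa>\<^sub>l" "0 < \<kappa>\<^sub>u"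
      and "\<forall>\<theta>\<in>l0_ball d (2 * s).
         \<kappa>\<^sub>l * L2_set \<theta> {..<d} \<le> 1 / sqrt (real n) * L2_set (mat_vec d X \<theta>) {..<n} \<and>
         1 / sqrt (real n) * L2_set (mat_vec d X \<theta>) {..<n} \<le> \<kappa>\<^sub>u * L2_set \<theta> {..<d}"
    then show "ennreal (1 / 384 * \<kappa>\<^sub>l\<^sup>2 * (\<sigma>\<^sup>2 / \<kappa>\<^sub>u\<^sup>2) * (real s * ln (real d / real s) / real n)) \<le>
        minimax_prediction_risk n d \<sigma> X (l0_ball d s)"
      by (intro sparse_minimax) auto
  qed simp
qed

end
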